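(* Let $(A,B,P)$ be an $\mathbb E$-contraction on a Hilbert space $\mathcal H$. Then: (1) $\overline{\mathrm{Ran}}(I-P)$ and $\mathrm{Ker}(I-P)$ reduce $A$ and $B$; (2) the restriction of $(A,B,P)$ to $\overline{\mathrm{Ran}}(I-P)$ is an $\mathbb E$-contraction; (3) the restriction of $(A,B,P)$ to $\mathrm{Ker}(I-P)$ is an $\mathbb E$-unitary.
   Context: All operators are bounded linear operators on complex Hilbert spaces. A closed subspace reduces $T$ if it is invariant under $T$ and $T^*$. The tetrablock is $\mathbb E=\{(x_1,x_2,x_3)\in\mathbb C^3:1-zx_1-wx_2+zwx_3\ne0\ \ \forall z,w\in\overline{\mathbb D}\}$, and $b\mathbb E=\{(a,b,p)\in\overline{\mathbb E}:|p|=1\}$. A compact set $K\subset\mathbb C^3$ is a spectral set for a commuting triple $\underline T$ if the Taylor joint spectrum of $\underline T$ lies in $K$ and $\|f(\underline T)\|\le\sup_K|f|$ for every rational function $f$ with poles off $K$. An $\mathbb E$-contraction is a commuting triple $(A,B,P)$ having $\overline{\mathbb E}$ as a spectral set (then $P$ is a contraction). An $\mathbb E$-unitary is a commuting triple of normal operators with Taylor joint spectrum contained in $b\mathbb E$. It is a known fact that for a contraction $P$ on $\mathcal H$, $\mathcal H=\mathrm{Ker}(I-P)\oplus\overline{\mathrm{Ran}}(I-P)$ orthogonally, and both summands reduce $P$. *)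

theory Defs
  imports "HOL-Analysis.Analysis" "HOL-Library.Poly_Mapping"
begin

text \<open>
  Complex Hilbert spaces. The real structure (addition, norm, real inner product, completeness)
  is the one of the library; the real inner product is the real part of the complex one, so that
  \<open>norm x = sqrt (Re (cinner x x))\<close>. The complex inner product is linear in its first argument.
\<close>

class chilbert_space = real_inner + complete_space +
  fixes scaleC :: "complex \<Rightarrow> 'a \<Rightarrow> 'a"  (infixr "*\<^sub>C" 75)
    and cinner :: "'a \<Rightarrow> 'a \<Rightarrow> complex"
  assumes scaleC_of_real: "complex_of_real r *\<^sub>C x = r *\<^sub>R x"
    and scaleC_add_right: "c *\<^sub>C (x + y) = c *\<^sub>C x + c *\<^sub>C y"
    and scaleC_add_left: "(c + d) *\<^sub>C x = c *\<^sub>C x + d *\<^sub>C x"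
    and scaleC_scaleC: "c *\<^sub>C (d *\<^sub>C x) = (c * d) *\<^sub>C x"
    and cinner_commute: "cinner x y = cnj (cinner y x)"
    and cinner_add_left: "cinner (x + y) z = cinner x z + cinner y z"
    and cinner_scaleC_left: "cinner (c *\<^sub>C x) y = c * cinner x y"
    and Re_cinner: "Re (cinner x y) = inner x y"

text \<open>
  All operator notions are relative to a closed subspace \<open>M\<close> of a Hilbert space type, regarded as a
  Hilbert space of its own; they depend only on the values of the operators on \<open>M\<close>. Thus a
  statement about \<open>T\<close> relative to an invariant \<open>M\<close> is a statement about the restriction of \<open>T\<close>
  to \<open>M\<close>, and the whole space is \<open>M = UNIV\<close>.
\<close>

definition closed_csubspace :: "'h::chilbert_space set \<Rightarrow> bool" where
  "closed_csubspace M \<longleftrightarrow>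
     closed M \<and> 0 \<in> M \<and> (\<forall>x\<in>M. \<forall>y\<in>M. x + y \<in> M) \<and> (\<forall>c. \<forall>x\<in>M. c *\<^sub>C x \<in> M)"

definition bounded_op_on :: "'h::chilbert_space set \<Rightarrow> ('h \<Rightarrow> 'h) \<Rightarrow> bool" where
  "bounded_op_on M T \<longleftrightarrow>
     T ` M \<subseteq> M \<and>
     (\<forall>x\<in>M. \<forall>y\<in>M. T (x + y) = T x + T y) \<and>
     (\<forall>c. \<forall>x\<in>M. T (c *\<^sub>C x) = c *\<^sub>C T x) \<and>
     (\<exists>K. \<forall>x\<in>M. norm (T x) \<le> K * norm x)"

text \<open>The relative version of \<^const>\<open>onorm\<close>; the convention \<open>t / 0 = 0\<close> covers \<open>x = 0\<close>.\<close>

definition onorm_on :: "'h::chilbert_space set \<Rightarrow> ('h \<Rightarrow> 'h) \<Rightarrow> real" where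
  "onorm_on M T = (SUP x\<in>M. norm (T x) / norm x)"

definition adjoint_on :: "'h::chilbert_space set \<Rightarrow> ('h \<Rightarrow> 'h) \<Rightarrow> 'h \<Rightarrow> 'h" where
  "adjoint_on M T y = (THE z. z \<in> M \<and> (\<forall>x\<in>M. cinner (T x) y = cinner x z))"

definition normal_on :: "'h::chilbert_space set \<Rightarrow> ('h \<Rightarrow> 'h) \<Rightarrow> bool" where
  "normal_on M T \<longleftrightarrow> bounded_op_on M T \<and>
     (\<forall>x\<in>M. T (adjoint_on M T x) = adjoint_on M T (T x))"

definition reduces :: "'h::chilbert_space set \<Rightarrow> ('h \<Rightarrow> 'h) \<Rightarrow> bool" where
  "reduces M T \<longleftrightarrow> closed_csubspace M \<and> T ` M \<subseteq> M \<and> adjoint_on UNIV T ` M \<subseteq> M"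

definition commuting_triple_on ::
    "'h::chilbert_space set \<Rightarrow> ('h \<Rightarrow> 'h) \<Rightarrow> ('h \<Rightarrow> 'h) \<Rightarrow> ('h \<Rightarrow> 'h) \<Rightarrow> bool" where
  "commuting_triple_on M T1 T2 T3 \<longleftrightarrow>
     closed_csubspace M \<and> bounded_op_on M T1 \<and> bounded_op_on M T2 \<and> bounded_op_on M T3 \<and>
     (\<forall>x\<in>M. T1 (T2 x) = T2 (T1 x) \<and> T1 (T3 x) = T3 (T1 x) \<and> T2 (T3 x) = T3 (T2 x))"

text \<open>
  The Koszul complex \<open>0 \<rightarrow> M \<rightarrow> M\<^sup>3 \<rightarrow> M\<^sup>3 \<rightarrow> M \<rightarrow> 0\<close> of a triple. With \<open>e\<^sub>1, e\<^sub>2, e\<^sub>3\<close> the generators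
  of the exterior algebra, the maps are left multiplication by \<open>T1 e\<^sub>1 + T2 e\<^sub>2 + T3 e\<^sub>3\<close>; degree two
  is written in the basis \<open>e\<^sub>1 \<and> e\<^sub>2, e\<^sub>1 \<and> e\<^sub>3, e\<^sub>2 \<and> e\<^sub>3\<close>.
\<close>

definition koszul0 :: "('h \<Rightarrow> 'h) \<Rightarrow> ('h \<Rightarrow> 'h) \<Rightarrow> ('h \<Rightarrow> 'h) \<Rightarrow> 'h \<Rightarrow> 'h \<times> 'h \<times> 'h" where
  "koszul0 T1 T2 T3 x = (T1 x, T2 x, T3 x)"

definition koszul1 ::
    "('h::chilbert_space \<Rightarrow> 'h) \<Rightarrow> ('h \<Rightarrow> 'h) \<Rightarrow> ('h \<Rightarrow> 'h) \<Rightarrow> 'h \<times> 'h \<times> 'h \<Rightarrow> 'h \<times> 'h \<times> 'h" where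
  "koszul1 T1 T2 T3 = (\<lambda>(x1, x2, x3). (T1 x2 - T2 x1, T1 x3 - T3 x1, T2 x3 - T3 x2))"

definition koszul2 ::
    "('h::chilbert_space \<Rightarrow> 'h) \<Rightarrow> ('h \<Rightarrow> 'h) \<Rightarrow> ('h \<Rightarrow> 'h) \<Rightarrow> 'h \<times> 'h \<times> 'h \<Rightarrow> 'h" where
  "koszul2 T1 T2 T3 = (\<lambda>(x12, x13, x23). T1 x23 - T2 x13 + T3 x12)"

definition koszul_exact_on ::
    "'h::chilbert_space set \<Rightarrow> ('h \<Rightarrow> 'h) \<Rightarrow> ('h \<Rightarrow> 'h) \<Rightarrow> ('h \<Rightarrow> 'h) \<Rightarrow> bool" where
  "koszul_exact_on M T1 T2 T3 \<longleftrightarrow>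
     {x \<in> M. koszul0 T1 T2 T3 x = 0} = {0} \<and>
     {u \<in> M \<times> M \<times> M. koszul1 T1 T2 T3 u = 0} = koszul0 T1 T2 T3 ` M \<and>
     {u \<in> M \<times> M \<times> M. koszul2 T1 T2 T3 u = 0} = koszul1 T1 T2 T3 ` (M \<times> M \<times> M) \<and>
     koszul2 T1 T2 T3 ` (M \<times> M \<times> M) = M"

definition taylor_spectrum_on ::
    "'h::chilbert_space set \<Rightarrow> ('h \<Rightarrow> 'h) \<Rightarrow> ('h \<Rightarrow> 'h) \<Rightarrow> ('h \<Rightarrow> 'h) \<Rightarrow> (complex \<times> complex \<times> complex) set"
  where
  "taylor_spectrum_on M T1 T2 T3 =
     {(l1, l2, l3). \<not> koszul_exact_on M
        (\<lambda>x. T1 x - l1 *\<^sub>C x) (\<lambda>x. T2 x - l2 *\<^sub>C x) (\<lambda>x. T3 x - l3 *\<^sub>C x)}"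

text \<open>Polynomials in three variables; the key \<open>(i, j, k)\<close> stands for \<open>X\<^sub>1\<^sup>i X\<^sub>2\<^sup>j X\<^sub>3\<^sup>k\<close>.\<close>

type_synonym poly3 = "(nat \<times> nat \<times> nat) \<Rightarrow>\<^sub>0 complex"

definition poly3_eval :: "poly3 \<Rightarrow> complex \<times> complex \<times> complex \<Rightarrow> complex" where
  "poly3_eval p = (\<lambda>(x1, x2, x3).
     \<Sum>(i, j, k)\<in>Poly_Mapping.keys p. Poly_Mapping.lookup p (i, j, k) * x1 ^ i * x2 ^ j * x3 ^ k)"

definition poly3_op ::
    "poly3 \<Rightarrow> ('h::chilbert_space \<Rightarrow> 'h) \<Rightarrow> ('h \<Rightarrow> 'h) \<Rightarrow> ('h \<Rightarrow> 'h) \<Rightarrow> 'h \<Rightarrow> 'h" where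
  "poly3_op p T1 T2 T3 x =
     (\<Sum>(i, j, k)\<in>Poly_Mapping.keys p.
        Poly_Mapping.lookup p (i, j, k) *\<^sub>C (T1 ^^ i) ((T2 ^^ j) ((T3 ^^ k) x)))"

definition inverse_op_on :: "'h::chilbert_space set \<Rightarrow> ('h \<Rightarrow> 'h) \<Rightarrow> ('h \<Rightarrow> 'h) \<Rightarrow> bool" where
  "inverse_op_on M S R \<longleftrightarrow> bounded_op_on M R \<and> (\<forall>x\<in>M. R (S x) = x \<and> S (R x) = x)"

text \<open>
  A rational function with poles off \<open>K\<close> is \<open>f = p / q\<close> with \<open>q\<close> without zeros on \<open>K\<close>, and
  \<open>f(T) = p(T) q(T)\<^sup>-\<^sup>1\<close>. The inverse \<open>R\<close> of \<open>q(T)\<close> is unique on \<open>M\<close>, and it always exists when the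
  Taylor spectrum lies in \<open>K\<close>, by the spectral mapping theorem; asserting its existence here
  only expresses that \<open>f(T)\<close> is defined.
\<close>

definition spectral_set_on ::
    "'h::chilbert_space set \<Rightarrow> (complex \<times> complex \<times> complex) set \<Rightarrow>
     ('h \<Rightarrow> 'h) \<Rightarrow> ('h \<Rightarrow> 'h) \<Rightarrow> ('h \<Rightarrow> 'h) \<Rightarrow> bool" where
  "spectral_set_on M K T1 T2 T3 \<longleftrightarrow>
     compact K \<and> taylor_spectrum_on M T1 T2 T3 \<subseteq> K \<and>
     (\<forall>p q. (\<forall>x\<in>K. poly3_eval q x \<noteq> 0) \<longrightarrow>
        (\<exists>R. inverse_op_on M (poly3_op q T1 T2 T3) R \<and>
             onorm_on M (poly3_op p T1 T2 T3 \<circ> R)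
               \<le> (SUP x\<in>K. cmod (poly3_eval p x / poly3_eval q x))))"

definition tetrablock :: "(complex \<times> complex \<times> complex) set" where
  "tetrablock = {(x1, x2, x3).
     \<forall>z w. cmod z \<le> 1 \<longrightarrow> cmod w \<le> 1 \<longrightarrow> 1 - z * x1 - w * x2 + z * w * x3 \<noteq> 0}"

definition b_tetrablock :: "(complex \<times> complex \<times> complex) set" where
  "b_tetrablock = {(a, b, p). (a, b, p) \<in> closure tetrablock \<and> cmod p = 1}"

definition E_contraction_on ::
    "'h::chilbert_space set \<Rightarrow> ('h \<Rightarrow> 'h) \<Rightarrow> ('h \<Rightarrow> 'h) \<Rightarrow> ('h \<Rightarrow> 'h) \<Rightarrow> bool" where
  "E_contraction_on M A B P \<longleftrightarrow>
     commuting_triple_on M A B P \<and> spectral_set_on M (closure tetrablock) A B P"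

definition E_unitary_on ::
    "'h::chilbert_space set \<Rightarrow> ('h \<Rightarrow> 'h) \<Rightarrow> ('h \<Rightarrow> 'h) \<Rightarrow> ('h \<Rightarrow> 'h) \<Rightarrow> bool" where
  "E_unitary_on M A B P \<longleftrightarrow>
     commuting_triple_on M A B P \<and> normal_on M A \<and> normal_on M B \<and> normal_on M P \<and>
     taylor_spectrum_on M A B P \<subseteq> b_tetrablock"

definition Ker_I_minus :: "('h::chilbert_space \<Rightarrow> 'h) \<Rightarrow> 'h set" where
  "Ker_I_minus P = {x. x - P x = 0}"

definition Ran_I_minus_closure :: "('h::chilbert_space \<Rightarrow> 'h) \<Rightarrow> 'h set" where
  "Ran_I_minus_closure P = closure (range (\<lambda>x. x - P x))"

end

theory Submission
  imports Defs
begin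

text \<open>
  The proof rests on three inequalities for vectors: \<open>\<parallel>P x\<parallel> \<le> \<parallel>x\<parallel>\<close> and, for \<open>\<bar>w\<bar> = 1\<close>,
  \<open>\<parallel>A x - w P x\<parallel> \<le> \<parallel>x - w B x\<parallel>\<close> and \<open>\<parallel>B x - w P x\<parallel> \<le> \<parallel>x - w A x\<parallel>\<close>. On the closed tetrablock the
  scalar versions with \<open>(x\<^sub>1, x\<^sub>2, x\<^sub>3)\<close> in place of \<open>(A, B, P)\<close> hold, because a function
  \<open>z \<mapsto> a - z b\<close> without zeros in the closed disc has \<open>\<bar>b\<bar> < \<bar>a\<bar>\<close>. The spectral set condition carries
  them over to operators (\<open>E_contraction_norm_le\<close>): if \<open>\<bar>p\<bar> \<le> \<bar>q\<bar>\<close> on the spectral set and \<open>q\<close> has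
  no zero there, then \<open>\<parallel>p(T) x\<parallel> \<le> \<parallel>q(T) x\<parallel>\<close>.

  A contraction \<open>P\<close> splits the space into the orthogonal sum of the closure of \<open>Ran (I - P)\<close> and
  \<open>Ker (I - P)\<close> (\<open>orthogonal_sum_Ran_Ker\<close>). Both summands are invariant under all operators that
  commute with \<open>P\<close>, and an invariant subspace whose orthogonal complement is invariant as well is
  reducing. The orthogonal projection \<open>Q\<close> onto a summand then commutes with \<open>A\<close>, \<open>B\<close> and \<open>P\<close>.
  Applying \<open>Q\<close> to preimages in the Koszul complex shows that exactness passes to the summand, so the
  Taylor spectrum shrinks. The inverses \<open>q(T)\<^sup>-\<^sup>1\<close> also commute with \<open>Q\<close>, and norms can only
  decrease. Hence both restrictions are \<open>\<bbbE>\<close>-contractions (\<open>E_contraction_on_restrict\<close>).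

  On \<open>Ker (I - P)\<close> one has \<open>P x = x\<close>. Squaring the two circle inequalities and letting \<open>w\<close> run through
  \<open>1, -1, \<i>, -\<i>\<close> gives \<open>\<langle>x, A x\<rangle> = \<langle>B x, x\<rangle>\<close> (\<open>cinner_eq_of_circle_bounds\<close>), so \<open>A\<^sup>* = B\<close> by
  polarization. As \<open>A\<close> and \<open>B\<close> commute, both are normal. If \<open>p \<noteq> 1\<close>, the operator \<open>P - p\<close> is an
  invertible scalar there and makes the Koszul complex exact; so every point of the Taylor spectrum
  has third coordinate \<open>1\<close> and lies in the distinguished boundary
  (\<open>E_unitary_on_of_identity\<close>).
\<close>

section \<open>Complex linear structure\<close>

lemma scaleC_one [simp]: "1 *\<^sub>C (x::'h::chilbert_space) = x"
  using scaleC_of_real[of 1 x] by simp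

lemma scaleC_zero_left [simp]: "0 *\<^sub>C (x::'h::chilbert_space) = 0"
  using scaleC_of_real[of 0 x] by simp

lemma scaleC_zero_right [simp]: "c *\<^sub>C (0::'h::chilbert_space) = 0"
  using scaleC_add_right[of c 0 0] by simp

lemma scaleC_minus_right: "c *\<^sub>C (- x::'h::chilbert_space) = - (c *\<^sub>C x)"
  using scaleC_add_right[of c x "- x"] by (simp add: eq_neg_iff_add_eq_0 add.commute)

lemma scaleC_minus_left: "(- c) *\<^sub>C (x::'h::chilbert_space) = - (c *\<^sub>C x)"
  using scaleC_add_left[of c "- c" x] by (simp add: eq_neg_iff_add_eq_0 add.commute)

lemma scaleC_diff_right: "c *\<^sub>C (x - y::'h::chilbert_space) = c *\<^sub>C x - c *\<^sub>C y"
  using scaleC_add_right[of c x "- y"] by (simp add: scaleC_minus_right)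

lemma cinner_add_right: "cinner (x::'h::chilbert_space) (y + z) = cinner x y + cinner x z"
  by (metis cinner_add_left cinner_commute complex_cnj_add)

lemma cinner_scaleC_right: "cinner (x::'h::chilbert_space) (c *\<^sub>C y) = cnj c * cinner x y"
  by (metis cinner_scaleC_left cinner_commute complex_cnj_mult complex_cnj_cnj)

lemma cinner_diff_right: "cinner (x::'h::chilbert_space) (y - z) = cinner x y - cinner x z"
  using cinner_add_right[of x "y - z" z] by simp

lemma Im_cinner: "Im (cinner x y) = inner (- \<i> *\<^sub>C (x::'h::chilbert_space)) y"
  by (simp flip: Re_cinner add: cinner_scaleC_left)

text \<open>
  An identity of real inner products that is stable under multiplication by \<open>- \<i>\<close> is an identity of
  complex ones, since \<open>Im c = Re (- \<i> c)\<close>. It lets the real Riesz theorem produce complex adjoints.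
\<close>

lemma cinner_eqI:
  assumes "\<And>x. inner (f x) y = inner (x::'h::chilbert_space) z"
    and "\<And>c x. f (c *\<^sub>C x) = c *\<^sub>C f x"
  shows "cinner (f x) y = cinner x z"
  using assms(1)[of x] assms(1)[of "- \<i> *\<^sub>C x"] assms(2)[of "- \<i>" x]
  by (simp add: complex_eq_iff Re_cinner Im_cinner)

lemma norm_scaleC: "norm (c *\<^sub>C x::'h::chilbert_space) = cmod c * norm x"
proof -
  have "(norm (c *\<^sub>C x))\<^sup>2 = Re (cinner (c *\<^sub>C x) (c *\<^sub>C x))"
    by (simp add: Re_cinner power2_norm_eq_inner)
  also have "cinner (c *\<^sub>C x) (c *\<^sub>C x) = of_real ((cmod c)\<^sup>2) * cinner x x"
    unfolding cinner_scaleC_left cinner_scaleC_right complex_norm_square by simp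
  also have "Re \<dots> = (cmod c * norm x)\<^sup>2"
    unfolding Re_complex_of_real Re_cinner
    by (simp add: Re_cinner power2_norm_eq_inner power_mult_distrib)
  finally show ?thesis
    by (simp add: power2_eq_iff_nonneg)
qed

lemma bounded_linear_scaleC: "bounded_linear (\<lambda>x::'h::chilbert_space. c *\<^sub>C x)"
  by (rule bounded_linear_intro[where K = "cmod c"])
    (simp_all add: scaleC_add_right norm_scaleC scaleC_scaleC mult.commute flip: scaleC_of_real)

lemma bounded_op_on_bounded_linear:
  assumes "bounded_op_on UNIV (T::'h::chilbert_space \<Rightarrow> 'h)"
  shows "bounded_linear T"
proof -
  obtain K where "\<forall>x. norm (T x) \<le> K * norm x"
    using assms by (auto simp: bounded_op_on_def)
  then show ?thesis
    using assms by (intro bounded_linear_intro[where K = K])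
      (auto simp: bounded_op_on_def mult.commute simp flip: scaleC_of_real)
qed

lemma closed_csubspace_subspace: "closed_csubspace M \<Longrightarrow> subspace (M::'h::chilbert_space set)"
  by (auto simp: closed_csubspace_def subspace_def simp flip: scaleC_of_real)


section \<open>Orthogonal projections and adjoints\<close>

text \<open>
  The variational principle behind both orthogonality proofs below: a linear term cannot stay below a
  quadratic one near \<open>0\<close>.
\<close>

lemma linear_term_zero_if_below_square:
  fixes b c :: real
  assumes "\<And>t. t * b \<le> t\<^sup>2 * c"
  shows "b = 0"
proof (rule ccontr)
  assume "b \<noteq> 0"
  define s where "s = \<bar>c\<bar> + 1"
  \<comment> \<open>this \<open>t\<close> maximizes \<open>t b - t\<^sup>2 s\<close>, and the maximum is positive\<close>
  define t where "t = b / (2 * s)"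
  have "s > 0" "c \<le> s"
    by (auto simp: s_def)
  have "t * b \<le> t\<^sup>2 * s"
    using assms[of t] mult_left_mono[OF \<open>c \<le> s\<close>, of "t\<^sup>2"] by simp
  also have "\<dots> = t * b / 2"
    using \<open>s > 0\<close> by (simp add: t_def power2_eq_square)
  finally have "t * b \<le> 0"
    by linarith
  moreover have "t * b = b\<^sup>2 / (2 * s)"
    by (simp add: t_def power2_eq_square)
  ultimately show False
    using \<open>b \<noteq> 0\<close> \<open>s > 0\<close> by (simp add: divide_le_0_iff)
qed

lemma norm_diff_scaleR_square:
  fixes u w :: "'a::real_inner"
  shows "(norm (u - t *\<^sub>R w))\<^sup>2 = (norm u)\<^sup>2 - t * (2 * inner u w) + t\<^sup>2 * (norm w)\<^sup>2"
  unfolding power2_norm_eq_inner inner_diff_left inner_diff_right inner_scaleR_left inner_scaleR_right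
    inner_commute[of w u] by (simp add: power2_eq_square algebra_simps)

lemma norm_diff_midpoint:
  fixes x v w :: "'a::real_inner"
  shows "(norm (v - w))\<^sup>2 =
    2 * (norm (x - v))\<^sup>2 + 2 * (norm (x - w))\<^sup>2 - 4 * (norm (x - (1/2) *\<^sub>R (v + w)))\<^sup>2"
proof -
  define p q where "p = x - v" and "q = x - w"
  have "v - w = q - p" "x - (1/2) *\<^sub>R (v + w) = (1/2) *\<^sub>R (p + q)"
    by (simp_all add: p_def q_def scaleR_add_right scaleR_diff_right flip: scaleR_add_left)
  moreover have "(norm (q - p))\<^sup>2 = 2 * (norm p)\<^sup>2 + 2 * (norm q)\<^sup>2 - (norm (p + q))\<^sup>2"
    unfolding power2_norm_eq_inner inner_diff_left inner_diff_right inner_add_left inner_add_right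
      inner_commute[of q p] by simp
  ultimately show ?thesis
    by (simp add: p_def q_def power_mult_distrib power_divide)
qed

text \<open>
  The nearest point of \<open>V\<close> to \<open>x\<close> has the required property. It exists because the sets of almost
  nearest points are nested, closed, and have diameters that tend to \<open>0\<close> by the parallelogram law.
\<close>

theorem orthogonal_decomposition_exists:
  fixes V :: "'a::{real_inner, complete_space} set"
  assumes V: "closed V" "subspace V"
  obtains v where "v \<in> V" "\<And>w. w \<in> V \<Longrightarrow> inner (x - v) w = 0"
proof -
  define d where "d = (INF v\<in>V. (norm (x - v))\<^sup>2)"
  have bdd: "bdd_below ((\<lambda>v. (norm (x - v))\<^sup>2) ` V)"
    by (rule bdd_belowI[of _ 0]) auto
  have "V \<noteq> {}"
    using V subspace_0 by blast
  have d_le: "d \<le> (norm (x - v))\<^sup>2" if "v \<in> V" for v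
    unfolding d_def using bdd that by (rule cINF_lower)
  define S where "S n = {v\<in>V. (norm (x - v))\<^sup>2 \<le> d + 1 / Suc n}" for n :: nat
  obtain a where a: "\<And>n. a \<in> S n"
  proof (rule decreasing_closed_nest)
    show "closed (S n)" for n
    proof -
      have "S n = V \<inter> {v. (norm (x - v))\<^sup>2 \<le> d + 1 / Suc n}"
        by (auto simp: S_def)
      then show ?thesis
        using V by (auto intro!: closed_Int closed_Collect_le continuous_intros)
    qed
    show "S n \<noteq> {}" for n
    proof -
      have "d < d + 1 / Suc n"
        by simp
      then obtain v where "v \<in> V" "(norm (x - v))\<^sup>2 < d + 1 / Suc n"
        unfolding d_def using cINF_less_iff[OF \<open>V \<noteq> {}\<close> bdd] by blast
      then show ?thesis
        by (auto simp: S_def)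
    qed
    show "S n \<subseteq> S m" if "m \<le> n" for m n
    proof -
      have "1 / real (Suc n) \<le> 1 / real (Suc m)"
        using that by (intro divide_left_mono) auto
      then show ?thesis
        by (auto simp: S_def)
    qed
    show "\<exists>n. \<forall>v\<in>S n. \<forall>w\<in>S n. dist v w < e" if "e > 0" for e
    proof -
      obtain n where n: "1 / Suc n < e\<^sup>2 / 4"
        using nat_approx_posE[of "e\<^sup>2 / 4"] \<open>e > 0\<close> zero_less_power[of e 2]
        by (metis zero_less_divide_iff zero_less_numeral)
      have "dist v w < e" if "v \<in> S n" "w \<in> S n" for v w
      proof -
        have "(1/2) *\<^sub>R (v + w) \<in> V"
          using that V by (auto simp: S_def intro!: subspace_scale subspace_add)
        moreover have "(norm (v - w))\<^sup>2 =
            2 * (norm (x - v))\<^sup>2 + 2 * (norm (x - w))\<^sup>2 - 4 * (norm (x - (1/2) *\<^sub>R (v + w)))\<^sup>2"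
          by (rule norm_diff_midpoint)
        moreover have "(norm (x - v))\<^sup>2 \<le> d + 1 / Suc n" "(norm (x - w))\<^sup>2 \<le> d + 1 / Suc n"
          using that by (auto simp: S_def)
        ultimately have "(norm (v - w))\<^sup>2 \<le> 4 * (1 / Suc n)"
          using d_le[of "(1/2) *\<^sub>R (v + w)"] by linarith
        also have "\<dots> < e\<^sup>2"
          using n by simp
        finally have "(norm (v - w))\<^sup>2 < e\<^sup>2" .
        from power2_less_imp_less[OF this less_imp_le[OF \<open>e > 0\<close>]] show ?thesis
          by (simp add: dist_norm)
      qed
      then show ?thesis
        by blast
    qed
  qed blast
  have "a \<in> V"
    using a by (auto simp: S_def)
  have "(norm (x - a))\<^sup>2 \<le> d"
  proof (rule field_le_epsilon)
    fix e :: real assume "e > 0"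
    then obtain n where "1 / Suc n < e"
      by (rule nat_approx_posE)
    then show "(norm (x - a))\<^sup>2 \<le> d + e"
      using a[of n] by (auto simp: S_def)
  qed
  have "inner (x - a) w = 0" if "w \<in> V" for w
  proof -
    have "t * (2 * inner (x - a) w) \<le> t\<^sup>2 * (norm w)\<^sup>2" for t
    proof -
      have "a + t *\<^sub>R w \<in> V"
        using \<open>a \<in> V\<close> that V by (simp add: subspace_add subspace_scale)
      then have "(norm (x - a))\<^sup>2 \<le> (norm ((x - a) - t *\<^sub>R w))\<^sup>2"
        using order_trans[OF \<open>(norm (x - a))\<^sup>2 \<le> d\<close> d_le] by (simp only: diff_diff_eq)
      also have "\<dots> = (norm (x - a))\<^sup>2 - t * (2 * inner (x - a) w) + t\<^sup>2 * (norm w)\<^sup>2"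
        by (rule norm_diff_scaleR_square)
      finally show ?thesis
        by simp
    qed
    from linear_term_zero_if_below_square[OF this] show ?thesis
      by simp
  qed
  with \<open>a \<in> V\<close> that show ?thesis
    by blast
qed

text \<open>
  A nonzero functional is determined by its value at one vector \<open>n\<close> orthogonal to its kernel, so the
  representing vector is a multiple of \<open>n\<close>.
\<close>

theorem riesz_representation:
  fixes f :: "'a::{real_inner, complete_space} \<Rightarrow> real"
  assumes "bounded_linear f"
  obtains z where "\<And>x. f x = inner x z"
proof (cases "\<forall>x. f x = 0")
  case True
  then show ?thesis
    using that[of 0] by simp
next
  case False
  then obtain x0 where x0: "f x0 \<noteq> 0"
    by blast
  interpret f: bounded_linear f
    by fact
  let ?V = "{x. f x = 0}"
  have "closed ?V"
    by (intro closed_Collect_eq f.continuous_on continuous_intros)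
  moreover have "subspace ?V"
    by (auto simp: subspace_def f.add f.scaleR f.zero)
  ultimately obtain v where v: "f v = 0" "\<And>w. f w = 0 \<Longrightarrow> inner (x0 - v) w = 0"
    using orthogonal_decomposition_exists[of ?V x0] by auto
  define n where "n = x0 - v"
  have n: "f n \<noteq> 0"
    using x0 v by (simp add: n_def f.diff)
  then have "n \<noteq> 0"
    using f.zero by auto
  have "f x = inner x ((f n / inner n n) *\<^sub>R n)" for x
  proof -
    have "f (x - (f x / f n) *\<^sub>R n) = 0"
      using n by (simp add: f.diff f.scaleR)
    then have "inner n x = f x / f n * inner n n"
      using v(2) by (fastforce simp: n_def[symmetric] inner_diff_right)
    then show ?thesis
      using n \<open>n \<noteq> 0\<close> by (simp add: inner_commute)
  qed
  then show ?thesis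
    by (rule that)
qed

lemma adjoint_on_eqI:
  assumes M: "closed_csubspace (M::'h::chilbert_space set)" and "z \<in> M"
    and z: "\<And>x. x \<in> M \<Longrightarrow> cinner (T x) y = cinner x z"
  shows "adjoint_on M T y = z"
  unfolding adjoint_on_def
proof (rule the_equality)
  show "z \<in> M \<and> (\<forall>x\<in>M. cinner (T x) y = cinner x z)"
    using assms by blast
next
  fix z' assume z': "z' \<in> M \<and> (\<forall>x\<in>M. cinner (T x) y = cinner x z')"
  have "z' - z \<in> M"
    using z' \<open>z \<in> M\<close> closed_csubspace_subspace[OF M] by (simp add: subspace_diff)
  then have "cinner (z' - z) (z' - z) = 0"
    using z z' by (simp add: cinner_diff_right)
  then have "inner (z' - z) (z' - z) = 0"
    by (simp flip: Re_cinner)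
  then show "z' = z"
    by simp
qed

text \<open>
  The operator \<^const>\<open>adjoint_on\<close> is a definite description; Riesz representation shows that it
  denotes the adjoint on the whole space.
\<close>

lemma cinner_adjoint:
  assumes "bounded_op_on UNIV (T::'h::chilbert_space \<Rightarrow> 'h)"
  shows "cinner (T x) y = cinner x (adjoint_on UNIV T y)"
proof -
  have "bounded_linear (\<lambda>x. inner (T x) y)"
    by (intro bounded_linear_compose[OF bounded_linear_inner_left]
        bounded_op_on_bounded_linear assms)
  then obtain z where z: "\<And>x. inner (T x) y = inner x z"
    using riesz_representation by blast
  have "T (c *\<^sub>C x) = c *\<^sub>C T x" for c x
    using assms by (auto simp: bounded_op_on_def)
  with z have "cinner (T x) y = cinner x z" for x
    by (rule cinner_eqI)
  moreover from this have "adjoint_on UNIV T y = z"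
    by (intro adjoint_on_eqI) (auto simp: closed_csubspace_def)
  ultimately show ?thesis
    by simp
qed

definition orthogonal_sum :: "'h::chilbert_space set \<Rightarrow> 'h set \<Rightarrow> bool" where
  "orthogonal_sum M N \<longleftrightarrow> closed_csubspace M \<and> closed_csubspace N \<and>
     (\<forall>m\<in>M. \<forall>n\<in>N. inner m n = 0) \<and> (\<forall>x. \<exists>m\<in>M. \<exists>n\<in>N. x = m + n)"

lemma orthogonal_sum_commute:
  assumes "orthogonal_sum M N"
  shows "orthogonal_sum N M"
proof -
  have "\<exists>n\<in>N. \<exists>m\<in>M. x = n + m" for x
    using assms unfolding orthogonal_sum_def by (metis add.commute)
  moreover have "inner n m = 0" if "n \<in> N" "m \<in> M" for m n
    using assms that by (subst inner_commute) (auto simp: orthogonal_sum_def)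
  ultimately show ?thesis
    using assms by (simp add: orthogonal_sum_def)
qed

text \<open>
  The adjoint preserves \<open>M\<close> because \<open>T\<close> preserves the orthogonal complement \<open>N\<close>: the component of
  \<open>T\<^sup>* y\<close> in \<open>N\<close> pairs with \<open>n \<in> N\<close> as \<open>\<langle>T n, y\<rangle> = 0\<close>.
\<close>

lemma reduces_of_orthogonal_sum:
  assumes MN: "orthogonal_sum M (N::'h::chilbert_space set)"
    and T: "bounded_op_on UNIV T" "T ` M \<subseteq> M" "T ` N \<subseteq> N"
  shows "reduces M T"
proof -
  have "adjoint_on UNIV T y \<in> M" if "y \<in> M" for y
  proof -
    obtain m n where mn: "m \<in> M" "n \<in> N" "adjoint_on UNIV T y = m + n"
      using MN by (meson orthogonal_sum_def)
    have "inner n (m + n) = inner (T n) y"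
      using cinner_adjoint[OF T(1), of n y] by (simp add: mn flip: Re_cinner)
    also have "\<dots> = 0"
      using MN T(3) mn(2) that by (auto simp: inner_commute[of "T n"] orthogonal_sum_def)
    finally have "inner n n = 0"
      using MN mn(1,2) by (simp add: inner_add_right inner_commute[of n m] orthogonal_sum_def)
    then show ?thesis
      using mn by simp
  qed
  then show ?thesis
    using MN T by (auto simp: reduces_def orthogonal_sum_def)
qed

text \<open>
  The component \<open>Q x\<close> of \<open>x\<close> in \<open>M\<close> is unique, since \<open>M \<inter> N = 0\<close>; linearity of \<open>Q\<close> and the commutation
  relations all follow by exhibiting the right decomposition (\<open>QI\<close> in the proof).
\<close>

lemma orthogonal_sum_projection:
  assumes MN: "orthogonal_sum M (N::'h::chilbert_space set)"
  obtains Q where "bounded_op_on UNIV Q" "range Q \<subseteq> M" "\<And>x. x \<in> M \<Longrightarrow> Q x = x"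
    "\<And>T x. bounded_op_on UNIV T \<Longrightarrow> T ` M \<subseteq> M \<Longrightarrow> T ` N \<subseteq> N \<Longrightarrow> Q (T x) = T (Q x)"
proof -
  have sub: "subspace M" "subspace N"
    and orth: "\<And>m n. m \<in> M \<Longrightarrow> n \<in> N \<Longrightarrow> inner m n = 0"
    using MN closed_csubspace_subspace by (auto simp: orthogonal_sum_def)
  have "\<exists>m. m \<in> M \<and> x - m \<in> N" for x
    using MN unfolding orthogonal_sum_def by (metis add_diff_cancel_left')
  then obtain Q where Q: "\<And>x. Q x \<in> M" "\<And>x. x - Q x \<in> N"
    by metis
  have QI: "Q x = m" if "m \<in> M" "x - m \<in> N" for x m
  proof -
    have "Q x - m \<in> M"
      using Q that sub by (simp add: subspace_diff)
    moreover have "(x - m) - (x - Q x) \<in> N"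
      by (rule subspace_diff[OF sub(2) that(2) Q(2)])
    ultimately have "inner (Q x - m) (Q x - m) = 0"
      using orth by fastforce
    then show ?thesis
      by simp
  qed
  have add: "Q (x + y) = Q x + Q y" for x y
  proof (rule QI)
    show "x + y - (Q x + Q y) \<in> N"
      using subspace_add[OF sub(2) Q(2)[of x] Q(2)[of y]] by (simp add: algebra_simps)
  qed (use Q sub in \<open>auto intro: subspace_add\<close>)
  have scale: "Q (c *\<^sub>C x) = c *\<^sub>C Q x" for c x
  proof (rule QI)
    show "c *\<^sub>C x - c *\<^sub>C Q x \<in> N"
      using MN Q(2)[of x] by (simp add: orthogonal_sum_def closed_csubspace_def flip: scaleC_diff_right)
  qed (use MN Q in \<open>auto simp: orthogonal_sum_def closed_csubspace_def\<close>)
  have "norm (Q x) \<le> 1 * norm x" for x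
  proof -
    have "(norm (Q x + (x - Q x)))\<^sup>2 = (norm (Q x))\<^sup>2 + (norm (x - Q x))\<^sup>2"
      using orth[OF Q(1) Q(2)] by (intro norm_add_Pythagorean) (simp add: orthogonal_def)
    then have "(norm (Q x))\<^sup>2 \<le> (norm x)\<^sup>2"
      by simp
    then show ?thesis
      by simp
  qed
  then have "bounded_op_on UNIV Q"
    using add scale by (auto simp: bounded_op_on_def intro!: exI[of _ 1])
  moreover have "Q x = x" if "x \<in> M" for x
    using that sub by (intro QI) (auto simp: subspace_0)
  moreover have "Q (T x) = T (Q x)" if "bounded_op_on UNIV T" "T ` M \<subseteq> M" "T ` N \<subseteq> N" for T x
  proof (rule QI)
    show "T (Q x) \<in> M"
      using that Q by auto
    have "T (x - Q x) \<in> N"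
      using that Q by auto
    then show "T x - T (Q x) \<in> N"
      using linear_diff[OF bounded_linear.linear[OF bounded_op_on_bounded_linear[OF that(1)]]]
      by simp
  qed
  ultimately show ?thesis
    using that Q(1) by blast
qed


section \<open>Polynomials of operators\<close>

text \<open>
  The sums that define a polynomial and its operator version range over its support, which depends on
  which coefficients vanish. Over a fixed larger index set they can be computed uniformly.
\<close>

lemma poly3_eval_superset:
  assumes "finite S" "Poly_Mapping.keys p \<subseteq> S"
  shows "poly3_eval p (x1, x2, x3) =
    (\<Sum>(i, j, k)\<in>S. Poly_Mapping.lookup p (i, j, k) * x1 ^ i * x2 ^ j * x3 ^ k)"
  unfolding poly3_eval_def prod.case
  by (rule sum.mono_neutral_left) (use assms in \<open>auto simp: in_keys_iff\<close>)

lemma poly3_op_superset: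
  assumes "finite S" "Poly_Mapping.keys p \<subseteq> S"
  shows "poly3_op p T1 T2 T3 x =
    (\<Sum>(i, j, k)\<in>S. Poly_Mapping.lookup p (i, j, k) *\<^sub>C (T1 ^^ i) ((T2 ^^ j) ((T3 ^^ k) x)))"
  unfolding poly3_op_def
  by (rule sum.mono_neutral_left) (use assms in \<open>auto simp: in_keys_iff\<close>)

definition linear_poly3 :: "complex \<Rightarrow> complex \<Rightarrow> complex \<Rightarrow> complex \<Rightarrow> poly3" where
  "linear_poly3 c a1 a2 a3 =
     Poly_Mapping.single (0, 0, 0) c + Poly_Mapping.single (1, 0, 0) a1 +
     Poly_Mapping.single (0, 1, 0) a2 + Poly_Mapping.single (0, 0, 1) a3"

lemma keys_linear_poly3:
  "Poly_Mapping.keys (linear_poly3 c a1 a2 a3) \<subseteq> {(0, 0, 0), (1, 0, 0), (0, 1, 0), (0, 0, 1)}"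
  by (auto simp: linear_poly3_def in_keys_iff lookup_add lookup_single when_def split: if_splits)

lemma poly3_eval_linear:
  "poly3_eval (linear_poly3 c a1 a2 a3) (x1, x2, x3) = c + a1 * x1 + a2 * x2 + a3 * x3"
  by (subst poly3_eval_superset[OF _ keys_linear_poly3])
    (simp_all add: linear_poly3_def lookup_add lookup_single)

lemma poly3_op_linear:
  "poly3_op (linear_poly3 c a1 a2 a3) T1 T2 T3 x =
     c *\<^sub>C x + a1 *\<^sub>C T1 x + a2 *\<^sub>C T2 x + a3 *\<^sub>C T3 x"
  by (subst poly3_op_superset[OF _ keys_linear_poly3])
    (simp_all add: linear_poly3_def lookup_add lookup_single add.assoc)

lemma bounded_op_on_id: "bounded_op_on M (\<lambda>x::'h::chilbert_space. x)"
  unfolding bounded_op_on_def by (auto intro: exI[of _ 1])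

lemma bounded_op_on_compose:
  assumes "bounded_op_on M S" "bounded_op_on M (T::'h::chilbert_space \<Rightarrow> 'h)"
  shows "bounded_op_on M (\<lambda>x. S (T x))"
proof -
  obtain K L where KL: "\<forall>x\<in>M. norm (S x) \<le> K * norm x" "\<forall>x\<in>M. norm (T x) \<le> L * norm x"
    using assms by (auto simp: bounded_op_on_def)
  have "norm (S (T x)) \<le> (\<bar>K\<bar> * L) * norm x" if "x \<in> M" for x
  proof -
    have "norm (S (T x)) \<le> K * norm (T x)"
      using KL assms that by (auto simp: bounded_op_on_def)
    also have "\<dots> \<le> \<bar>K\<bar> * norm (T x)"
      by (simp add: mult_right_mono)
    also have "\<dots> \<le> \<bar>K\<bar> * (L * norm x)"
      using KL that by (simp add: mult_left_mono)
    finally show ?thesis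
      by (simp add: mult.assoc)
  qed
  then show ?thesis
    using assms unfolding bounded_op_on_def by (auto simp: image_subset_iff)
qed

lemma bounded_op_on_funpow:
  "bounded_op_on M T \<Longrightarrow> bounded_op_on M (T ^^ n)" for T :: "'h::chilbert_space \<Rightarrow> 'h"
proof (induction n)
  case 0
  then show ?case
    using bounded_op_on_id by (simp add: id_def)
next
  case (Suc n)
  then show ?case
    using bounded_op_on_compose[of M T "T ^^ n"] by (simp add: comp_def)
qed

lemma bounded_op_on_scaleC:
  assumes "closed_csubspace M" "bounded_op_on M (T::'h::chilbert_space \<Rightarrow> 'h)"
  shows "bounded_op_on M (\<lambda>x. c *\<^sub>C T x)"
proof (rule bounded_op_on_compose[OF _ assms(2)])
  show "bounded_op_on M (\<lambda>x. c *\<^sub>C x)"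
    using assms(1) unfolding bounded_op_on_def
    by (auto simp: closed_csubspace_def scaleC_add_right scaleC_scaleC norm_scaleC mult.commute
        intro!: exI[of _ "cmod c"])
qed

lemma bounded_op_on_add:
  assumes "closed_csubspace M" "bounded_op_on M S" "bounded_op_on M (T::'h::chilbert_space \<Rightarrow> 'h)"
  shows "bounded_op_on M (\<lambda>x. S x + T x)"
proof -
  obtain K L where KL: "\<forall>x\<in>M. norm (S x) \<le> K * norm x" "\<forall>x\<in>M. norm (T x) \<le> L * norm x"
    using assms by (auto simp: bounded_op_on_def)
  have "norm (S x + T x) \<le> (K + L) * norm x" if "x \<in> M" for x
    using KL that norm_triangle_ineq[of "S x" "T x"] by (fastforce simp: algebra_simps)
  then have "\<exists>K. \<forall>x\<in>M. norm (S x + T x) \<le> K * norm x"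
    by blast
  then show ?thesis
    using assms unfolding bounded_op_on_def closed_csubspace_def
    by (auto simp: image_subset_iff scaleC_add_right add_ac)
qed

lemma bounded_op_on_sum:
  assumes M: "closed_csubspace (M::'h::chilbert_space set)"
    and "finite I" "\<And>i. i \<in> I \<Longrightarrow> bounded_op_on M (T i)"
  shows "bounded_op_on M (\<lambda>x. \<Sum>i\<in>I. T i x)"
  using assms(2,3)
proof (induction I rule: finite_induct)
  case empty
  show ?case
    using M by (auto simp: bounded_op_on_def closed_csubspace_def intro: exI[of _ 0])
next
  case (insert i I)
  then show ?case
    using bounded_op_on_add[OF M] by simp
qed

lemma bounded_op_on_poly3_op:
  assumes "commuting_triple_on M T1 T2 (T3::'h::chilbert_space \<Rightarrow> 'h)"
  shows "bounded_op_on M (poly3_op p T1 T2 T3)"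
proof -
  have "bounded_op_on M (\<lambda>x. \<Sum>l\<in>Poly_Mapping.keys p. Poly_Mapping.lookup p l *\<^sub>C
      (T1 ^^ fst l) ((T2 ^^ fst (snd l)) ((T3 ^^ snd (snd l)) x)))"
    using assms unfolding commuting_triple_on_def
    by (intro bounded_op_on_sum bounded_op_on_scaleC
        bounded_op_on_compose[OF bounded_op_on_funpow bounded_op_on_compose[OF
            bounded_op_on_funpow bounded_op_on_funpow]]) auto
  then show ?thesis
    by (simp add: poly3_op_def[abs_def] case_prod_beta')
qed

lemma funpow_commute_apply:
  "(\<And>x. Q (T x) = T (Q x)) \<Longrightarrow> Q ((T ^^ n) x) = (T ^^ n) (Q x)"
  by (induction n) auto

lemma poly3_op_commute:
  assumes "bounded_op_on UNIV (Q::'h::chilbert_space \<Rightarrow> 'h)"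
    and "\<And>x. Q (T1 x) = T1 (Q x)" "\<And>x. Q (T2 x) = T2 (Q x)" "\<And>x. Q (T3 x) = T3 (Q x)"
  shows "Q (poly3_op p T1 T2 T3 x) = poly3_op p T1 T2 T3 (Q x)"
proof -
  have "linear Q" "\<And>c x. Q (c *\<^sub>C x) = c *\<^sub>C Q x"
    using assms(1) bounded_linear.linear bounded_op_on_bounded_linear
    by (auto simp: bounded_op_on_def)
  then show ?thesis
    unfolding poly3_op_def
    by (simp add: linear_sum case_prod_beta' funpow_commute_apply[of Q] assms(2-))
qed


section \<open>Operator norms and the von Neumann inequality\<close>

lemma onorm_on_bdd_above:
  assumes "bounded_op_on M (T::'h::chilbert_space \<Rightarrow> 'h)"
  shows "bdd_above ((\<lambda>x. norm (T x) / norm x) ` M)"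
proof -
  obtain K where K: "\<forall>x\<in>M. norm (T x) \<le> K * norm x"
    using assms by (auto simp: bounded_op_on_def)
  have "norm (T x) / norm x \<le> \<bar>K\<bar>" if "x \<in> M" for x
    using K that by (cases "x = 0") (auto simp: divide_le_eq intro: order_trans mult_right_mono)
  then show ?thesis
    by (auto intro!: bdd_aboveI[of _ "\<bar>K\<bar>"])
qed

lemma norm_le_onorm_on:
  assumes "bounded_op_on M (T::'h::chilbert_space \<Rightarrow> 'h)" "x \<in> M"
  shows "norm (T x) \<le> onorm_on M T * norm x"
proof (cases "x = 0")
  case True
  obtain K where "\<forall>x\<in>M. norm (T x) \<le> K * norm x"
    using assms by (auto simp: bounded_op_on_def)
  with assms True show ?thesis
    by fastforce
next
  case False
  have "norm (T x) / norm x \<le> onorm_on M T"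
    unfolding onorm_on_def using onorm_on_bdd_above[OF assms(1)] assms(2) by (intro cSUP_upper)
  then show ?thesis
    using False by (simp add: divide_le_eq)
qed

lemma onorm_on_mono:
  assumes "bounded_op_on N (T::'h::chilbert_space \<Rightarrow> 'h)" "M \<subseteq> N" "M \<noteq> {}"
  shows "onorm_on M T \<le> onorm_on N T"
  unfolding onorm_on_def using assms(2,3) onorm_on_bdd_above[OF assms(1)]
  by (intro cSUP_subset_mono) auto

lemma zero_in_tetrablock: "(0, 0, 0) \<in> tetrablock"
  by (simp add: tetrablock_def)

text \<open>
  The norm bound for \<open>f = p / q\<close> gives \<open>\<parallel>p(T) q(T)\<^sup>-\<^sup>1\<parallel> \<le> 1\<close>, which is applied to the vector \<open>q(T) x\<close>. In
  this form the inverse of \<open>q(T)\<close> no longer appears.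
\<close>

lemma E_contraction_norm_le:
  assumes "E_contraction_on M A B (P::'h::chilbert_space \<Rightarrow> 'h)"
    and q: "\<And>x. x \<in> closure tetrablock \<Longrightarrow> poly3_eval q x \<noteq> 0"
    and pq: "\<And>x. x \<in> closure tetrablock \<Longrightarrow> cmod (poly3_eval p x) \<le> cmod (poly3_eval q x)"
    and "x \<in> M"
  shows "norm (poly3_op p A B P x) \<le> norm (poly3_op q A B P x)"
proof -
  have T: "commuting_triple_on M A B P" and "spectral_set_on M (closure tetrablock) A B P"
    using assms(1) by (auto simp: E_contraction_on_def)
  then obtain R where R: "inverse_op_on M (poly3_op q A B P) R"
    and le: "onorm_on M (poly3_op p A B P \<circ> R)
               \<le> (SUP x\<in>closure tetrablock. cmod (poly3_eval p x / poly3_eval q x))"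
    using q unfolding spectral_set_on_def by metis
  note le
  also have "(SUP x\<in>closure tetrablock. cmod (poly3_eval p x / poly3_eval q x)) \<le> 1"
    using zero_in_tetrablock q pq
    by (intro cSUP_least) (auto simp: norm_divide divide_le_eq)
  finally have le1: "onorm_on M (poly3_op p A B P \<circ> R) \<le> 1" .
  have y: "poly3_op q A B P x \<in> M"
    using bounded_op_on_poly3_op[OF T, of q] \<open>x \<in> M\<close> by (auto simp: bounded_op_on_def)
  have "bounded_op_on M (poly3_op p A B P \<circ> R)"
    unfolding comp_def using R
    by (intro bounded_op_on_compose[OF bounded_op_on_poly3_op[OF T]]) (auto simp: inverse_op_on_def)
  from norm_le_onorm_on[OF this y]
  have "norm (poly3_op p A B P x)
      \<le> onorm_on M (poly3_op p A B P \<circ> R) * norm (poly3_op q A B P x)"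
    using R \<open>x \<in> M\<close> by (simp add: inverse_op_on_def)
  also have "\<dots> \<le> 1 * norm (poly3_op q A B P x)"
    using le1 by (intro mult_right_mono) auto
  finally show ?thesis
    by simp
qed


section \<open>Geometry of the tetrablock\<close>

lemma tetrablock_swap:
  assumes "(x1, x2, x3) \<in> tetrablock"
  shows "(x2, x1, x3) \<in> tetrablock"
proof -
  have "1 - z * x2 - w * x1 + z * w * x3 \<noteq> 0" if "cmod z \<le> 1" "cmod w \<le> 1" for z w
  proof -
    have "1 - w * x1 - z * x2 + w * z * x3 \<noteq> 0"
      using assms that by (auto simp: tetrablock_def)
    then show ?thesis
      by (simp add: algebra_simps)
  qed
  then show ?thesis
    by (auto simp: tetrablock_def)
qed

text \<open>
  If \<open>\<bar>a\<bar> \<le> \<bar>b\<bar>\<close>, then \<open>a / b\<close> is a zero in the closed disc; if \<open>b = 0\<close> then also \<open>a = 0\<close>, and the default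
  value \<open>a / 0 = 0\<close> is such a zero.
\<close>

lemma less_of_no_zero_in_disc:
  assumes "\<And>z. cmod z \<le> 1 \<Longrightarrow> a - z * b \<noteq> 0"
  shows "cmod b < cmod a"
proof (rule ccontr)
  assume "\<not> cmod b < cmod a"
  then have "cmod (a / b) \<le> 1"
    by (cases "b = 0") (auto simp: norm_divide divide_le_eq_1)
  moreover have "a - (a / b) * b = 0"
    using \<open>\<not> cmod b < cmod a\<close> by (cases "b = 0") auto
  ultimately show False
    using assms by blast
qed

text \<open>
  For fixed \<open>w\<close> the defining polynomial of the tetrablock is affine in \<open>z\<close>, namely
  \<open>(1 - w x\<^sub>2) - z (x\<^sub>1 - w x\<^sub>3)\<close>.
\<close>

lemma tetrablock_bounds:
  assumes x: "(x1, x2, x3) \<in> tetrablock"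
  shows "cmod x2 < 1" and "cmod w \<le> 1 \<Longrightarrow> cmod (x1 - w * x3) < cmod (1 - w * x2)"
proof -
  have nz: "1 - z * x1 - w * x2 + z * w * x3 \<noteq> 0" if "cmod z \<le> 1" "cmod w \<le> 1" for z w
    using x that by (auto simp: tetrablock_def)
  show "cmod x2 < 1"
    using less_of_no_zero_in_disc[of 1 x2] nz[of 0] by simp
  show "cmod (x1 - w * x3) < cmod (1 - w * x2)" if "cmod w \<le> 1"
  proof (rule less_of_no_zero_in_disc)
    fix z :: complex assume "cmod z \<le> 1"
    then show "(1 - w * x2) - z * (x1 - w * x3) \<noteq> 0"
      using nz[OF _ that, of z] by (simp add: algebra_simps)
  qed
qed

text \<open>
  Adding the squares of the previous bound for \<open>w = 1\<close> and \<open>w = -1\<close> yields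
  \<open>\<bar>x\<^sub>1\<bar>\<^sup>2 + \<bar>x\<^sub>3\<bar>\<^sup>2 < 1 + \<bar>x\<^sub>2\<bar>\<^sup>2\<close>, and the sum with the same inequality for \<open>x\<^sub>1\<close> and \<open>x\<^sub>2\<close> interchanged
  leaves \<open>\<bar>x\<^sub>3\<bar>\<^sup>2 < 1\<close>.
\<close>

lemma tetrablock_x3_less_1:
  assumes x: "(x1, x2, x3) \<in> tetrablock"
  shows "cmod x3 < 1"
proof -
  have *: "(cmod x1)\<^sup>2 + (cmod x3)\<^sup>2 < 1 + (cmod x2)\<^sup>2" if "(x1, x2, x3) \<in> tetrablock" for x1 x2
  proof -
    have par: "(cmod (u - v))\<^sup>2 + (cmod (u + v))\<^sup>2 = 2 * ((cmod u)\<^sup>2 + (cmod v)\<^sup>2)" for u v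
      unfolding cmod_power2 by (simp add: power2_eq_square algebra_simps)
    have "(cmod (x1 - x3))\<^sup>2 < (cmod (1 - x2))\<^sup>2" "(cmod (x1 + x3))\<^sup>2 < (cmod (1 + x2))\<^sup>2"
      using tetrablock_bounds(2)[OF that, of 1] tetrablock_bounds(2)[OF that, of "- 1"]
      by (auto intro!: power_strict_mono)
    then show ?thesis
      using par[of x1 x3] par[of 1 x2] by simp
  qed
  have "(cmod x3)\<^sup>2 < 1\<^sup>2"
    using *[OF x] *[of x2 x1] x tetrablock_swap by fastforce
  then show ?thesis
    by (rule power2_less_imp_less) simp
qed

lemma closure_tetrablock_bounds:
  assumes x: "(x1, x2, x3) \<in> closure tetrablock"
  shows "cmod x1 \<le> 1" "cmod x2 \<le> 1" "cmod x3 \<le> 1"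
    and "cmod w \<le> 1 \<Longrightarrow> cmod (x1 - w * x3) \<le> cmod (1 - w * x2)"
    and "cmod w \<le> 1 \<Longrightarrow> cmod (x2 - w * x3) \<le> cmod (1 - w * x1)"
proof -
  let ?F = "{x. cmod (fst x) \<le> 1 \<and> cmod (fst (snd x)) \<le> 1 \<and> cmod (snd (snd x)) \<le> 1 \<and>
      (\<forall>w. cmod w \<le> 1 \<longrightarrow>
         cmod (fst x - w * snd (snd x)) \<le> cmod (1 - w * fst (snd x)) \<and>
         cmod (fst (snd x) - w * snd (snd x)) \<le> cmod (1 - w * fst x))}"
  have "tetrablock \<subseteq> ?F"
  proof
    fix y :: "complex \<times> complex \<times> complex"
    assume y: "y \<in> tetrablock"
    obtain y1 y2 y3 where [simp]: "y = (y1, y2, y3)"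
      by (cases y)
    show "y \<in> ?F"
      using y tetrablock_swap[of y1 y2 y3] tetrablock_bounds[of y1 y2 y3]
        tetrablock_bounds[of y2 y1 y3] tetrablock_x3_less_1[of y1 y2 y3]
      by (auto intro: less_imp_le)
  qed
  moreover have "closed ?F"
    by (intro closed_Collect_conj closed_Collect_all closed_Collect_imp closed_Collect_le
        continuous_intros) auto
  ultimately have "closure tetrablock \<subseteq> ?F"
    by (rule closure_minimal)
  with x show "cmod x1 \<le> 1" "cmod x2 \<le> 1" "cmod x3 \<le> 1"
    "cmod w \<le> 1 \<Longrightarrow> cmod (x1 - w * x3) \<le> cmod (1 - w * x2)"
    "cmod w \<le> 1 \<Longrightarrow> cmod (x2 - w * x3) \<le> cmod (1 - w * x1)"
    by auto
qed

lemma one_minus_nonzero: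
  fixes w a :: complex
  assumes "cmod w < 1" "cmod a \<le> 1"
  shows "1 - w * a \<noteq> 0"
proof
  assume "1 - w * a = 0"
  then have "cmod w * cmod a = 1"
    by (metis eq_iff_diff_eq_0 norm_mult norm_one)
  moreover have "cmod w * cmod a \<le> cmod w * 1"
    using assms by (intro mult_left_mono) auto
  ultimately show False
    using assms by simp
qed

lemma E_contraction_contraction:
  assumes "E_contraction_on M A B (P::'h::chilbert_space \<Rightarrow> 'h)" "x \<in> M"
  shows "norm (P x) \<le> norm x"
proof -
  have "norm (poly3_op (linear_poly3 0 0 0 1) A B P x) \<le> norm (poly3_op (linear_poly3 1 0 0 0) A B P x)"
    by (rule E_contraction_norm_le[OF assms(1) _ _ assms(2)])
      (auto simp: poly3_eval_linear closure_tetrablock_bounds)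
  then show ?thesis
    by (simp add: poly3_op_linear)
qed

text \<open>
  The denominators \<open>1 - w x\<^sub>2\<close> and \<open>1 - w x\<^sub>1\<close> are free of zeros on the closed tetrablock only for
  \<open>\<bar>w\<bar> < 1\<close>; the operator inequalities reach the unit circle by a radial limit.
\<close>

lemma norm_le_extend_to_circle:
  fixes a b c d :: "'h::chilbert_space"
  assumes "\<And>w. cmod w < 1 \<Longrightarrow> norm (a - w *\<^sub>C b) \<le> norm (c - w *\<^sub>C d)"
    and "cmod w = 1"
  shows "norm (a - w *\<^sub>C b) \<le> norm (c - w *\<^sub>C d)"
proof -
  have ev: "\<forall>\<^sub>F t in at_left (1::real). norm (a - t *\<^sub>R (w *\<^sub>C b)) \<le> norm (c - t *\<^sub>R (w *\<^sub>C d))"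
    using eventually_at_left_real[of 0 "1::real"]
  proof (rule eventually_mono)
    fix t :: real assume "t \<in> {0<..<1}"
    then have "cmod (of_real t * w) < 1"
      using assms(2) by (simp add: norm_mult)
    from assms(1)[OF this] show "norm (a - t *\<^sub>R (w *\<^sub>C b)) \<le> norm (c - t *\<^sub>R (w *\<^sub>C d))"
      by (simp flip: scaleC_scaleC add: scaleC_of_real)
  qed simp
  have lim: "((\<lambda>t. norm (u - t *\<^sub>R v)) \<longlongrightarrow> norm (u - 1 *\<^sub>R v)) (at_left 1)" for u v :: 'h
    by (intro tendsto_intros)
  show ?thesis
    using tendsto_le[OF _ lim[of c "w *\<^sub>C d"] lim[of a "w *\<^sub>C b"] ev] by simp
qed

text \<open>
  The rational functions are \<open>(x\<^sub>1 - w x\<^sub>3) / (1 - w x\<^sub>2)\<close> and \<open>(x\<^sub>2 - w x\<^sub>3) / (1 - w x\<^sub>1)\<close>.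
\<close>

lemma E_contraction_circle_bounds:
  assumes E: "E_contraction_on M A B (P::'h::chilbert_space \<Rightarrow> 'h)" and x: "x \<in> M"
    and w: "cmod w = 1"
  shows "norm (A x - w *\<^sub>C P x) \<le> norm (x - w *\<^sub>C B x)"
    and "norm (B x - w *\<^sub>C P x) \<le> norm (x - w *\<^sub>C A x)"
proof -
  have *: "norm (A x - w *\<^sub>C P x) \<le> norm (x - w *\<^sub>C B x) \<and>
      norm (B x - w *\<^sub>C P x) \<le> norm (x - w *\<^sub>C A x)" if "cmod w < 1" for w
  proof
    have nz: "1 - w * x1 \<noteq> 0" "1 - w * x2 \<noteq> 0" if "(x1, x2, x3) \<in> closure tetrablock" for x1 x2 x3
      using one_minus_nonzero \<open>cmod w < 1\<close> closure_tetrablock_bounds[OF that] by auto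
    have "norm (poly3_op (linear_poly3 0 1 0 (- w)) A B P x)
        \<le> norm (poly3_op (linear_poly3 1 0 (- w) 0) A B P x)"
      by (rule E_contraction_norm_le[OF E _ _ x])
        (use that nz in \<open>auto simp: poly3_eval_linear closure_tetrablock_bounds(4)\<close>)
    then show "norm (A x - w *\<^sub>C P x) \<le> norm (x - w *\<^sub>C B x)"
      by (simp add: poly3_op_linear scaleC_minus_left)
    have "norm (poly3_op (linear_poly3 0 0 1 (- w)) A B P x)
        \<le> norm (poly3_op (linear_poly3 1 (- w) 0 0) A B P x)"
      by (rule E_contraction_norm_le[OF E _ _ x])
        (use that nz in \<open>auto simp: poly3_eval_linear closure_tetrablock_bounds(5)\<close>)
    then show "norm (B x - w *\<^sub>C P x) \<le> norm (x - w *\<^sub>C A x)"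
      by (simp add: poly3_op_linear scaleC_minus_left)
  qed
  show "norm (A x - w *\<^sub>C P x) \<le> norm (x - w *\<^sub>C B x)"
    "norm (B x - w *\<^sub>C P x) \<le> norm (x - w *\<^sub>C A x)"
    by (rule norm_le_extend_to_circle[OF _ w]; use * in blast)+
qed


section \<open>Restriction to a reducing subspace\<close>

definition projection_onto :: "'h::chilbert_space set \<Rightarrow> ('h \<Rightarrow> 'h) \<Rightarrow> bool" where
  "projection_onto M Q \<longleftrightarrow> bounded_op_on UNIV Q \<and> range Q \<subseteq> M \<and> (\<forall>x\<in>M. Q x = x)"

lemma projection_onto_invariant:
  assumes "projection_onto M Q" "\<And>x. Q (T x) = T (Q x)"
  shows "T ` M \<subseteq> M"
proof
  fix y assume "y \<in> T ` M"
  then obtain x where "x \<in> M" "y = T x"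
    by blast
  then have "y = Q y"
    using assms by (auto simp: projection_onto_def)
  then show "y \<in> M"
    using assms(1) unfolding projection_onto_def by (metis rangeI subsetD)
qed

text \<open>
  The projection is a chain map of the Koszul complex onto the one of \<open>M\<close>, and it fixes the latter.
  So a direct summand of an exact complex is exact: project any preimage to \<open>M\<close>.
\<close>

lemma koszul_exact_on_restrict:
  fixes M :: "'h::chilbert_space set"
  assumes Q: "projection_onto M Q"
    and comm: "\<And>x. Q (T1 x) = T1 (Q x)" "\<And>x. Q (T2 x) = T2 (Q x)" "\<And>x. Q (T3 x) = T3 (Q x)"
    and ex: "koszul_exact_on UNIV T1 T2 T3"
  shows "koszul_exact_on M T1 T2 T3"
proof -
  define Q3 where "Q3 = (\<lambda>(x, y, z). (Q x, Q y, Q z))"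
  have lin: "linear Q"
    using Q bounded_linear.linear bounded_op_on_bounded_linear by (auto simp: projection_onto_def)
  have QM: "Q x \<in> M" for x
    using Q by (auto simp: projection_onto_def)
  have Qid: "Q x = x" if "x \<in> M" for x
    using Q that by (simp add: projection_onto_def)
  have Q3M: "Q3 u \<in> M \<times> M \<times> M" for u
    by (auto simp: Q3_def QM split: prod.split)
  have Q3id: "Q3 u = u" if "u \<in> M \<times> M \<times> M" for u
    using that by (auto simp: Q3_def Qid)
  have k0: "Q3 (koszul0 T1 T2 T3 x) = koszul0 T1 T2 T3 (Q x)" for x
    by (simp add: Q3_def koszul0_def comm)
  have k1: "Q3 (koszul1 T1 T2 T3 u) = koszul1 T1 T2 T3 (Q3 u)" for u
    by (simp add: Q3_def koszul1_def comm linear_diff[OF lin] split: prod.split)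
  have k2: "Q (koszul2 T1 T2 T3 u) = koszul2 T1 T2 T3 (Q3 u)" for u
    by (simp add: Q3_def koszul2_def comm linear_diff[OF lin] linear_add[OF lin] split: prod.split)
  have ex0: "{x. koszul0 T1 T2 T3 x = 0} = {0}"
    and ex1: "{u. koszul1 T1 T2 T3 u = 0} = range (koszul0 T1 T2 T3)"
    and ex2: "{u. koszul2 T1 T2 T3 u = 0} = range (koszul1 T1 T2 T3)"
    and ex3: "range (koszul2 T1 T2 T3) = UNIV"
    using ex by (simp_all add: koszul_exact_on_def)
  have "0 \<in> M"
    using QM[of 0] linear_0[OF lin] by simp
  show ?thesis
    unfolding koszul_exact_on_def
  proof (intro conjI)
    show "{x \<in> M. koszul0 T1 T2 T3 x = 0} = {0}"
      using ex0 \<open>0 \<in> M\<close> by blast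
    show "{u \<in> M \<times> M \<times> M. koszul1 T1 T2 T3 u = 0} = koszul0 T1 T2 T3 ` M"
    proof (intro equalityI subsetI)
      fix u assume u: "u \<in> {u \<in> M \<times> M \<times> M. koszul1 T1 T2 T3 u = 0}"
      then obtain x where "u = koszul0 T1 T2 T3 x"
        using ex1 by blast
      then have "u = koszul0 T1 T2 T3 (Q x)"
        using u k0 Q3id by (metis (lifting) mem_Collect_eq)
      then show "u \<in> koszul0 T1 T2 T3 ` M"
        using QM by blast
    next
      fix u assume "u \<in> koszul0 T1 T2 T3 ` M"
      then obtain x where "x \<in> M" "u = koszul0 T1 T2 T3 x"
        by blast
      then have "u = Q3 u" "koszul1 T1 T2 T3 u = 0"
        using k0[of x] Qid ex1 by auto
      then show "u \<in> {u \<in> M \<times> M \<times> M. koszul1 T1 T2 T3 u = 0}"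
        using Q3M[of u] by simp
    qed
    show "{u \<in> M \<times> M \<times> M. koszul2 T1 T2 T3 u = 0} = koszul1 T1 T2 T3 ` (M \<times> M \<times> M)"
    proof (intro equalityI subsetI)
      fix u assume u: "u \<in> {u \<in> M \<times> M \<times> M. koszul2 T1 T2 T3 u = 0}"
      then obtain v where "u = koszul1 T1 T2 T3 v"
        using ex2 by blast
      then have "u = koszul1 T1 T2 T3 (Q3 v)"
        using u k1 Q3id by (metis (lifting) mem_Collect_eq)
      then show "u \<in> koszul1 T1 T2 T3 ` (M \<times> M \<times> M)"
        using Q3M by blast
    next
      fix u assume "u \<in> koszul1 T1 T2 T3 ` (M \<times> M \<times> M)"
      then obtain v where v: "v \<in> M \<times> M \<times> M" "u = koszul1 T1 T2 T3 v"
        by blast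
      then have "u = Q3 u" "koszul2 T1 T2 T3 u = 0"
        using k1[of v] Q3id[OF v(1)] ex2 by auto
      then show "u \<in> {u \<in> M \<times> M \<times> M. koszul2 T1 T2 T3 u = 0}"
        using Q3M[of u] by simp
    qed
    show "koszul2 T1 T2 T3 ` (M \<times> M \<times> M) = M"
    proof (intro equalityI subsetI)
      fix y assume "y \<in> koszul2 T1 T2 T3 ` (M \<times> M \<times> M)"
      then obtain v where v: "v \<in> M \<times> M \<times> M" "y = koszul2 T1 T2 T3 v"
        by blast
      then have "y = Q y"
        using k2[of v] Q3id[OF v(1)] by simp
      then show "y \<in> M"
        using QM by metis
    next
      fix y assume y: "y \<in> M"
      obtain v where "y = koszul2 T1 T2 T3 v"
        using ex3 by (metis UNIV_I imageE)
      then have "y = koszul2 T1 T2 T3 (Q3 v)"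
        using k2[of v] Qid[OF y] by simp
      then show "y \<in> koszul2 T1 T2 T3 ` (M \<times> M \<times> M)"
        using Q3M by blast
    qed
  qed
qed

lemma bounded_op_on_restrict:
  "bounded_op_on N T \<Longrightarrow> M \<subseteq> N \<Longrightarrow> T ` M \<subseteq> M \<Longrightarrow> bounded_op_on M T"
  unfolding bounded_op_on_def by blast

lemma E_contraction_on_restrict:
  fixes M :: "'h::chilbert_space set"
  assumes E: "E_contraction_on UNIV A B P" and M: "closed_csubspace M" and Q: "projection_onto M Q"
    and comm: "\<And>x. Q (A x) = A (Q x)" "\<And>x. Q (B x) = B (Q x)" "\<And>x. Q (P x) = P (Q x)"
  shows "E_contraction_on M A B P"
proof -
  have T: "commuting_triple_on UNIV A B P" and S: "spectral_set_on UNIV (closure tetrablock) A B P"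
    using E by (auto simp: E_contraction_on_def)
  have Qb: "bounded_op_on UNIV Q" and QM: "\<And>x. Q x \<in> M"
    using Q by (auto simp: projection_onto_def)
  have "M \<noteq> {}"
    using QM by auto
  have T_M: "commuting_triple_on M A B P"
    using T M projection_onto_invariant[OF Q] comm unfolding commuting_triple_on_def
    by (auto intro!: bounded_op_on_restrict[of UNIV])
  have "taylor_spectrum_on M A B P \<subseteq> taylor_spectrum_on UNIV A B P"
  proof -
    have "Q (T x - c *\<^sub>C x) = T (Q x) - c *\<^sub>C Q x" if "Q (T x) = T (Q x)" for T c x
      using that Qb linear_diff[OF bounded_linear.linear[OF bounded_op_on_bounded_linear[OF Qb]]]
      by (simp add: bounded_op_on_def)
    then show ?thesis
      unfolding taylor_spectrum_on_def using koszul_exact_on_restrict[OF Q] comm by fastforce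
  qed
  moreover have "\<exists>R. inverse_op_on M (poly3_op q A B P) R \<and>
             onorm_on M (poly3_op p A B P \<circ> R)
               \<le> (SUP x\<in>closure tetrablock. cmod (poly3_eval p x / poly3_eval q x))"
    if q: "\<forall>x\<in>closure tetrablock. poly3_eval q x \<noteq> 0" for p q
  proof -
    obtain R where R: "inverse_op_on UNIV (poly3_op q A B P) R"
      and le: "onorm_on UNIV (poly3_op p A B P \<circ> R)
               \<le> (SUP x\<in>closure tetrablock. cmod (poly3_eval p x / poly3_eval q x))"
      using S q unfolding spectral_set_on_def by metis
    have Rb: "bounded_op_on UNIV R" and inv: "\<And>x. R (poly3_op q A B P x) = x"
      "\<And>x. poly3_op q A B P (R x) = x"
      using R by (auto simp: inverse_op_on_def)
    have "Q (R x) = R (Q x)" for x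
      using poly3_op_commute[where Q = Q and p = q and x = "R x", OF Qb] comm inv by metis
    then have "bounded_op_on M R"
      by (intro bounded_op_on_restrict[OF Rb] projection_onto_invariant[OF Q]) auto
    then have "inverse_op_on M (poly3_op q A B P) R"
      using inv by (simp add: inverse_op_on_def)
    moreover have "onorm_on M (poly3_op p A B P \<circ> R) \<le> onorm_on UNIV (poly3_op p A B P \<circ> R)"
      using bounded_op_on_compose[OF bounded_op_on_poly3_op[OF T] Rb] \<open>M \<noteq> {}\<close>
      by (intro onorm_on_mono) (auto simp: comp_def)
    ultimately show ?thesis
      using le by (meson order_trans)
  qed
  ultimately show ?thesis
    using T_M S unfolding E_contraction_on_def spectral_set_on_def by blast
qed


section \<open>The decomposition induced by a contraction\<close>

lemma closed_csubspace_closure: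
  fixes S :: "'h::chilbert_space set"
  assumes "0 \<in> S" and add: "\<And>x y. x \<in> S \<Longrightarrow> y \<in> S \<Longrightarrow> x + y \<in> S"
    and scale: "\<And>c x. x \<in> S \<Longrightarrow> c *\<^sub>C x \<in> S"
  shows "closed_csubspace (closure S)"
proof -
  have "x + y \<in> closure S" if xy: "x \<in> closure S" "y \<in> closure S" for x y
  proof -
    obtain f g where "\<forall>n. f n \<in> S" "f \<longlonglongrightarrow> x" "\<forall>n. g n \<in> S" "g \<longlonglongrightarrow> y"
      using xy unfolding closure_sequential by blast
    then have "\<forall>n. f n + g n \<in> S" "(\<lambda>n. f n + g n) \<longlonglongrightarrow> x + y"
      using add by (auto intro: tendsto_add)
    then show ?thesis
      unfolding closure_sequential by (intro exI[of _ "\<lambda>n. f n + g n"]) auto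
  qed
  moreover have "c *\<^sub>C x \<in> closure S" if "x \<in> closure S" for c x
    using closure_bounded_linear_image_subset[OF bounded_linear_scaleC[of c], of S]
      closure_mono[of "(*\<^sub>C) c ` S" S] scale that by blast
  ultimately show ?thesis
    using \<open>0 \<in> S\<close> closure_subset[of S] by (auto simp: closed_csubspace_def)
qed

text \<open>
  Compare the norms of \<open>x - t y\<close> and of its image \<open>x - t P y\<close>: the squares have the same constant term,
  so their linear terms in \<open>t\<close> must agree. This replaces the usual step from \<open>P x = x\<close> to \<open>P\<^sup>* x = x\<close>.
\<close>

lemma fixed_vector_orthogonal_Ran_I_minus:
  fixes P :: "'a::real_inner \<Rightarrow> 'a"
  assumes "linear P" and contr: "\<And>x. norm (P x) \<le> norm x" and x: "P x = x"
  shows "inner x (y - P y) = 0"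
proof -
  have "t * (2 * inner x (y - P y)) \<le> t\<^sup>2 * ((norm y)\<^sup>2 - (norm (P y))\<^sup>2)" for t
  proof -
    have "(norm (x - t *\<^sub>R P y))\<^sup>2 \<le> (norm (x - t *\<^sub>R y))\<^sup>2"
      using contr[of "x - t *\<^sub>R y"] x
      by (simp add: linear_diff[OF assms(1)] linear_scale[OF assms(1)])
    then show ?thesis
      unfolding norm_diff_scaleR_square by (simp add: inner_diff_right algebra_simps)
  qed
  then show ?thesis
    using linear_term_zero_if_below_square by fastforce
qed

text \<open>
  A vector \<open>n\<close> orthogonal to \<open>Ran (I - P)\<close> satisfies \<open>\<langle>n, n - P n\<rangle> = 0\<close>, hence
  \<open>\<parallel>n - P n\<parallel>\<^sup>2 = \<parallel>P n\<parallel>\<^sup>2 - \<parallel>n\<parallel>\<^sup>2 \<le> 0\<close>; so the complement of the closed range consists of fixed vectors.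
\<close>

lemma orthogonal_sum_Ran_Ker:
  assumes P: "bounded_op_on UNIV (P::'h::chilbert_space \<Rightarrow> 'h)" and contr: "\<And>x. norm (P x) \<le> norm x"
  shows "orthogonal_sum (Ran_I_minus_closure P) (Ker_I_minus P)"
proof -
  have bl: "bounded_linear P"
    by (rule bounded_op_on_bounded_linear[OF P])
  note lin = bounded_linear.linear[OF bl]
  have Padd: "P (x + y) = P x + P y" and Pscale: "P (c *\<^sub>C x) = c *\<^sub>C P x" for c x y
    using P by (auto simp: bounded_op_on_def)
  have M: "closed_csubspace (Ran_I_minus_closure P)"
    unfolding Ran_I_minus_closure_def
  proof (rule closed_csubspace_closure)
    show "0 \<in> range (\<lambda>x. x - P x)"
      using linear_0[OF lin] by (auto intro!: image_eqI[of _ _ 0])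
    show "u + v \<in> range (\<lambda>x. x - P x)" if uv: "u \<in> range (\<lambda>x. x - P x)" "v \<in> range (\<lambda>x. x - P x)" for u v
    proof -
      obtain x y where "u = x - P x" "v = y - P y"
        using uv by blast
      then have "u + v = (x + y) - P (x + y)"
        by (simp add: Padd)
      then show ?thesis
        by blast
    qed
    show "c *\<^sub>C u \<in> range (\<lambda>x. x - P x)" if u: "u \<in> range (\<lambda>x. x - P x)" for c u
    proof -
      obtain x where "u = x - P x"
        using u by blast
      then have "c *\<^sub>C u = (c *\<^sub>C x) - P (c *\<^sub>C x)"
        by (simp add: Pscale scaleC_diff_right)
      then show ?thesis
        by blast
    qed
  qed
  have "closed (Ker_I_minus P)"
    unfolding Ker_I_minus_def
    by (intro closed_Collect_eq continuous_intros bounded_linear.continuous_on[OF bl])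
  then have N: "closed_csubspace (Ker_I_minus P)"
    using Padd Pscale linear_0[OF lin] by (auto simp: closed_csubspace_def Ker_I_minus_def)
  have orth: "inner m n = 0" if m: "m \<in> Ran_I_minus_closure P" and n: "n \<in> Ker_I_minus P" for m n
  proof -
    have "range (\<lambda>x. x - P x) \<subseteq> {z. inner n z = 0}"
      using n fixed_vector_orthogonal_Ran_I_minus[OF lin contr, of n] by (auto simp: Ker_I_minus_def)
    moreover have "closed {z. inner n z = 0}"
      by (intro closed_Collect_eq continuous_intros)
    ultimately have "m \<in> {z. inner n z = 0}"
      using m closure_minimal unfolding Ran_I_minus_closure_def by blast
    then show ?thesis
      by (simp add: inner_commute)
  qed
  have "\<exists>m\<in>Ran_I_minus_closure P. \<exists>n\<in>Ker_I_minus P. x = m + n" for x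
  proof -
    obtain m where m: "m \<in> Ran_I_minus_closure P"
      and "\<And>w. w \<in> Ran_I_minus_closure P \<Longrightarrow> inner (x - m) w = 0"
      using orthogonal_decomposition_exists[OF _ closed_csubspace_subspace[OF M]] M
      unfolding closed_csubspace_def by metis
    moreover define n where "n = x - m"
    moreover have "n - P n \<in> Ran_I_minus_closure P"
      unfolding Ran_I_minus_closure_def using closure_subset by fastforce
    ultimately have "inner n (n - P n) = 0"
      by simp
    then have "(norm (n - P n))\<^sup>2 = (norm (P n))\<^sup>2 - (norm n)\<^sup>2"
      unfolding power2_norm_eq_inner by (simp add: inner_diff_left inner_diff_right inner_commute)
    also have "\<dots> \<le> 0"
      using contr[of n] by simp
    finally have "n \<in> Ker_I_minus P"
      by (simp add: Ker_I_minus_def)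
    moreover have "x = m + n"
      by (simp add: n_def)
    ultimately show ?thesis
      using m by blast
  qed
  then show ?thesis
    using M N orth by (auto simp: orthogonal_sum_def)
qed

lemma Ker_I_minus_invariant:
  "(\<And>x. T (P x) = P (T x)) \<Longrightarrow> T ` Ker_I_minus P \<subseteq> Ker_I_minus P"
  by (auto simp: Ker_I_minus_def) metis

lemma Ran_I_minus_closure_invariant:
  assumes "bounded_linear T" "\<And>x. T (P x) = P (T x)"
  shows "T ` Ran_I_minus_closure P \<subseteq> Ran_I_minus_closure P"
proof -
  have "T ` range (\<lambda>x. x - P x) \<subseteq> range (\<lambda>x. x - P x)"
    using assms(2) linear_diff[OF bounded_linear.linear[OF assms(1)]] by auto
  then show ?thesis
    unfolding Ran_I_minus_closure_def
    using closure_bounded_linear_image_subset[OF assms(1)] closure_mono by (meson order_trans)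
qed


section \<open>Normality on the fixed space\<close>

text \<open>
  After squaring, \<open>\<parallel>x\<parallel>\<^sup>2\<close> cancels and what remains is a constant plus a term of the form
  \<open>Re (w\<^sup>* c)\<close>, which changes sign with \<open>w\<close>. The two inequalities therefore first force \<open>\<parallel>u\<parallel> = \<parallel>v\<parallel>\<close>, and
  then \<open>c = 0\<close>.
\<close>

lemma cinner_eq_of_circle_bounds:
  fixes x u v :: "'h::chilbert_space"
  assumes "\<And>w. cmod w = 1 \<Longrightarrow> norm (u - w *\<^sub>C x) \<le> norm (x - w *\<^sub>C v)"
    and "\<And>w. cmod w = 1 \<Longrightarrow> norm (v - w *\<^sub>C x) \<le> norm (x - w *\<^sub>C u)"
  shows "cinner x u = cinner v x"
proof -
  have ex: "(norm (a - w *\<^sub>C b))\<^sup>2 = (norm a)\<^sup>2 - 2 * Re (cnj w * cinner a b) + (norm b)\<^sup>2"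
    if "cmod w = 1" for a b :: 'h and w
  proof -
    have "(norm (a - w *\<^sub>C b))\<^sup>2 = (norm a)\<^sup>2 - 2 * inner a (w *\<^sub>C b) + (norm (w *\<^sub>C b))\<^sup>2"
      using norm_diff_scaleR_square[of a 1 "w *\<^sub>C b"] by simp
    then show ?thesis
      by (simp add: norm_scaleC that cinner_scaleC_right flip: Re_cinner)
  qed
  have 1: "(norm u)\<^sup>2 - 2 * Re (cnj w * cinner u x) \<le> (norm v)\<^sup>2 - 2 * Re (cnj w * cinner x v)"
    "(norm v)\<^sup>2 - 2 * Re (cnj w * cinner v x) \<le> (norm u)\<^sup>2 - 2 * Re (cnj w * cinner x u)"
    if "cmod w = 1" for w
    using power_mono[OF assms(1)[OF that] norm_ge_zero, of 2]
      power_mono[OF assms(2)[OF that] norm_ge_zero, of 2] by (simp_all add: ex that)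
  have "cinner u x = cnj (cinner x u)" "cinner x v = cnj (cinner v x)"
    by (rule cinner_commute)+
  then show ?thesis
    using 1[of 1] 1[of "- 1"] 1[of \<i>] 1[of "- \<i>"] by (simp add: complex_eq_iff)
qed

lemma cinner_polarization:
  fixes N :: "'h::chilbert_space set"
  assumes N: "closed_csubspace N" and A: "bounded_op_on N A" and B: "bounded_op_on N B"
    and diag: "\<And>x. x \<in> N \<Longrightarrow> cinner x (A x) = cinner (B x) x"
    and xy: "x \<in> N" "y \<in> N"
  shows "cinner x (A y) = cinner (B x) y"
proof -
  define s where "s x y = cinner x (A y) - cinner (B x) y" for x y
  have s0: "s z z = 0" if "z \<in> N" for z
    using diag that by (simp add: s_def)
  have iy: "\<i> *\<^sub>C y \<in> N"
    using N xy by (simp add: closed_csubspace_def)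
  have add: "s (x + z) (x + z) = s x x + s x z + s z x + s z z" if "z \<in> N" for z
    using A B xy that
    by (simp add: s_def bounded_op_on_def cinner_add_left cinner_add_right)
  have *: "s x z + s z x = 0" if "z \<in> N" for z
    using add[OF that] s0 that xy N by (simp add: closed_csubspace_def)
  have "s x (\<i> *\<^sub>C y) = - \<i> * s x y" "s (\<i> *\<^sub>C y) x = \<i> * s y x"
    using A B xy
    by (simp_all add: s_def bounded_op_on_def cinner_scaleC_left cinner_scaleC_right algebra_simps)
  with *[OF iy] have "\<i> * (s y x - s x y) = 0"
    by (simp add: algebra_simps)
  with *[OF xy(2)] have "s x y = 0"
    by simp
  then show ?thesis
    by (simp add: s_def)
qed

text \<open>
  A contracting homotopy is given by \<open>c\<^sup>-\<^sup>1\<close> times contraction with the third generator: it sends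
  \<open>(x\<^sub>1, x\<^sub>2, x\<^sub>3)\<close> to \<open>c\<^sup>-\<^sup>1 x\<^sub>3\<close>, then \<open>(x\<^sub>1\<^sub>2, x\<^sub>1\<^sub>3, x\<^sub>2\<^sub>3)\<close> to \<open>(- c\<^sup>-\<^sup>1 x\<^sub>1\<^sub>3, - c\<^sup>-\<^sup>1 x\<^sub>2\<^sub>3, 0)\<close>, and \<open>y\<close> to
  \<open>(c\<^sup>-\<^sup>1 y, 0, 0)\<close>. These are the preimages used below.
\<close>

lemma koszul_exact_on_of_scalar:
  fixes M :: "'h::chilbert_space set"
  assumes M: "closed_csubspace M" and T: "bounded_op_on M T1" "bounded_op_on M T2"
    and comm: "\<And>x. x \<in> M \<Longrightarrow> T1 (T2 x) = T2 (T1 x)"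
    and T3: "\<And>x. x \<in> M \<Longrightarrow> T3 x = c *\<^sub>C x" and "c \<noteq> 0"
  shows "koszul_exact_on M T1 T2 T3"
proof -
  have scale: "T1 (a *\<^sub>C x) = a *\<^sub>C T1 x" "T2 (a *\<^sub>C x) = a *\<^sub>C T2 x" if "x \<in> M" for a x
    using T that by (auto simp: bounded_op_on_def)
  have mem: "T1 x \<in> M" "T2 x \<in> M" "a *\<^sub>C x \<in> M" if "x \<in> M" for a x
    using T M that by (auto simp: bounded_op_on_def closed_csubspace_def)
  have mem2: "x + y \<in> M" "x - y \<in> M" "0 \<in> M" if "x \<in> M" "y \<in> M" for x y
    using closed_csubspace_subspace[OF M] that
    by (auto intro: subspace_add subspace_diff subspace_0)
  have M0: "0 \<in> M"
    using M by (simp add: closed_csubspace_def)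
  have T0: "T1 0 = 0" "T2 0 = 0"
    using scale[OF M0, of 0] by simp_all
  have Tdiff: "T1 (x - y) = T1 x - T1 y" "T2 (x - y) = T2 x - T2 y" if "x \<in> M" "y \<in> M" for x y
    using T that mem2[OF that] unfolding bounded_op_on_def
    by (metis add_diff_cancel_right' diff_add_cancel)+
  have inv: "inverse c *\<^sub>C c *\<^sub>C x = x" "c *\<^sub>C inverse c *\<^sub>C x = x" for x :: 'h
    using \<open>c \<noteq> 0\<close> by (simp_all add: scaleC_scaleC)
  have inv_neg: "- (c *\<^sub>C (- inverse c) *\<^sub>C x) = x" for x :: 'h
    using inv by (simp add: scaleC_minus_left scaleC_minus_right)
  have inv_eq: "x = inverse c *\<^sub>C y" if "y = c *\<^sub>C x" for x y :: 'h
    using that inv by simp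
  show ?thesis
    unfolding koszul_exact_on_def
  proof (intro conjI)
    show "{x \<in> M. koszul0 T1 T2 T3 x = 0} = {0}"
      using M0 T0 T3 inv_eq by (fastforce simp: koszul0_def zero_prod_def)
    show "{u \<in> M \<times> M \<times> M. koszul1 T1 T2 T3 u = 0} = koszul0 T1 T2 T3 ` M"
    proof (intro equalityI subsetI)
      fix u assume "u \<in> {u \<in> M \<times> M \<times> M. koszul1 T1 T2 T3 u = 0}"
      then obtain x1 x2 x3 where u: "u = (x1, x2, x3)" "x1 \<in> M" "x2 \<in> M" "x3 \<in> M"
        "T1 x3 = c *\<^sub>C x1" "T2 x3 = c *\<^sub>C x2"
        using T3 by (auto simp: koszul1_def zero_prod_def)
      then have "u = koszul0 T1 T2 T3 (inverse c *\<^sub>C x3)"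
        using T3 mem(3) by (simp add: koszul0_def scale inv)
      then show "u \<in> koszul0 T1 T2 T3 ` M"
        using u mem(3) by blast
    next
      fix u assume "u \<in> koszul0 T1 T2 T3 ` M"
      then show "u \<in> {u \<in> M \<times> M \<times> M. koszul1 T1 T2 T3 u = 0}"
        using mem by (auto simp: koszul0_def koszul1_def zero_prod_def T3 comm scale)
    qed
    show "{u \<in> M \<times> M \<times> M. koszul2 T1 T2 T3 u = 0} = koszul1 T1 T2 T3 ` (M \<times> M \<times> M)"
    proof (intro equalityI subsetI)
      fix u assume "u \<in> {u \<in> M \<times> M \<times> M. koszul2 T1 T2 T3 u = 0}"
      then obtain x12 x13 x23 where u: "u = (x12, x13, x23)" "x12 \<in> M" "x13 \<in> M" "x23 \<in> M"
        and eq: "T1 x23 - T2 x13 + c *\<^sub>C x12 = 0"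
        using T3 by (auto simp: koszul2_def)
      have "T2 x13 - T1 x23 = c *\<^sub>C x12"
        using eq by (simp add: algebra_simps eq_neg_iff_add_eq_0)
      then have "inverse c *\<^sub>C T2 x13 - inverse c *\<^sub>C T1 x23 = x12"
        by (metis inv(1) scaleC_diff_right)
      then have "(- inverse c) *\<^sub>C T1 x23 - (- inverse c) *\<^sub>C T2 x13 = x12"
        by (simp add: scaleC_minus_left)
      then have "u = koszul1 T1 T2 T3 ((- inverse c) *\<^sub>C x13, (- inverse c) *\<^sub>C x23, 0)"
        using u M0 T0 T3 mem(3) inv_neg by (simp add: koszul1_def scale)
      then show "u \<in> koszul1 T1 T2 T3 ` (M \<times> M \<times> M)"
        using u mem(3) M0 by blast
    next
      fix u assume "u \<in> koszul1 T1 T2 T3 ` (M \<times> M \<times> M)"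
      then show "u \<in> {u \<in> M \<times> M \<times> M. koszul2 T1 T2 T3 u = 0}"
        by (auto simp: koszul1_def koszul2_def T3 mem mem2 Tdiff comm scale scaleC_diff_right)
    qed
    show "koszul2 T1 T2 T3 ` (M \<times> M \<times> M) = M"
    proof (intro equalityI subsetI)
      fix y assume "y \<in> koszul2 T1 T2 T3 ` (M \<times> M \<times> M)"
      then show "y \<in> M"
        by (auto simp: koszul2_def T3 mem mem2)
    next
      fix y assume y: "y \<in> M"
      then have "y = koszul2 T1 T2 T3 (inverse c *\<^sub>C y, 0, 0)"
        by (simp add: koszul2_def T3 mem T0 inv)
      then show "y \<in> koszul2 T1 T2 T3 ` (M \<times> M \<times> M)"
        using y mem(3) M0 by blast
    qed
  qed
qed

lemma taylor_spectrum_third_coordinate: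
  fixes M :: "'h::chilbert_space set"
  assumes T: "commuting_triple_on M T1 T2 T3" and T3: "\<And>x. x \<in> M \<Longrightarrow> T3 x = x"
    and l: "(l1, l2, l3) \<in> taylor_spectrum_on M T1 T2 T3"
  shows "l3 = 1"
proof (rule ccontr)
  assume "l3 \<noteq> 1"
  have M: "closed_csubspace M" and Tb: "bounded_op_on M T1" "bounded_op_on M T2"
    and comm: "\<And>x. x \<in> M \<Longrightarrow> T1 (T2 x) = T2 (T1 x)"
    using T by (auto simp: commuting_triple_on_def)
  have shift: "bounded_op_on M (\<lambda>x. S x - l *\<^sub>C x)" if "bounded_op_on M S" for S l
    using bounded_op_on_add[OF M that bounded_op_on_scaleC[OF M bounded_op_on_id, of "- l"]]
    by (simp add: scaleC_minus_left)
  have "koszul_exact_on M (\<lambda>x. T1 x - l1 *\<^sub>C x) (\<lambda>x. T2 x - l2 *\<^sub>C x) (\<lambda>x. T3 x - l3 *\<^sub>C x)"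
  proof (rule koszul_exact_on_of_scalar[OF M shift[OF Tb(1)] shift[OF Tb(2)]])
    show "T3 x - l3 *\<^sub>C x = (1 - l3) *\<^sub>C x" if "x \<in> M" for x
      using that T3 scaleC_add_left[of 1 "- l3" x] by (simp add: scaleC_minus_left)
    show "T1 (T2 x - l2 *\<^sub>C x) - l1 *\<^sub>C (T2 x - l2 *\<^sub>C x) =
          T2 (T1 x - l1 *\<^sub>C x) - l2 *\<^sub>C (T1 x - l1 *\<^sub>C x)" if x: "x \<in> M" for x
    proof -
      have mem: "T1 x \<in> M" "T2 x \<in> M" "a *\<^sub>C x \<in> M" for a
        using x Tb M by (auto simp: bounded_op_on_def closed_csubspace_def)
      have d: "S (u + v) = S u + S v" "S (a *\<^sub>C u) = a *\<^sub>C S u"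
        if "bounded_op_on M S" "u \<in> M" "v \<in> M" for S u v a
        using that by (auto simp: bounded_op_on_def)
      have "T1 (T2 x + (- l2) *\<^sub>C x) = T1 (T2 x) + (- l2) *\<^sub>C T1 x"
        "T2 (T1 x + (- l1) *\<^sub>C x) = T2 (T1 x) + (- l1) *\<^sub>C T2 x"
        using d Tb mem x by simp_all
      then show ?thesis
        using comm[OF x] by (simp add: scaleC_minus_left scaleC_diff_right scaleC_scaleC mult.commute)
    qed
    show "1 - l3 \<noteq> 0"
      using \<open>l3 \<noteq> 1\<close> by simp
  qed
  with l show False
    by (simp add: taylor_spectrum_on_def)
qed

text \<open>
  Here the circle inequalities give \<open>A\<^sup>* = B\<close>, which makes the commuting operators \<open>A\<close> and \<open>B\<close> normal.
\<close>

lemma E_unitary_on_of_identity: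
  fixes N :: "'h::chilbert_space set"
  assumes E: "E_contraction_on N A B P" and P: "\<And>x. x \<in> N \<Longrightarrow> P x = x"
  shows "E_unitary_on N A B P"
proof -
  have T: "commuting_triple_on N A B P" and S: "spectral_set_on N (closure tetrablock) A B P"
    using E by (auto simp: E_contraction_on_def)
  have N: "closed_csubspace N" and b: "bounded_op_on N A" "bounded_op_on N B" "bounded_op_on N P"
    and comm: "\<And>x. x \<in> N \<Longrightarrow> A (B x) = B (A x)"
    using T by (auto simp: commuting_triple_on_def)
  have mem: "A x \<in> N" "B x \<in> N" if "x \<in> N" for x
    using b that by (auto simp: bounded_op_on_def)
  have "cinner x (A x) = cinner (B x) x" if "x \<in> N" for x
    by (rule cinner_eq_of_circle_bounds)
      (use E_contraction_circle_bounds[OF E that] P[OF that] in auto)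
  then have AB: "cinner x (A y) = cinner (B x) y" if "x \<in> N" "y \<in> N" for x y
    using cinner_polarization[OF N b(1,2)] that by blast
  have "adjoint_on N A y = B y" if y: "y \<in> N" for y
  proof (rule adjoint_on_eqI[OF N mem(2)[OF y]])
    show "cinner (A x) y = cinner x (B y)" if "x \<in> N" for x
      using AB[OF y that] cinner_commute[of "A x" y] cinner_commute[of x "B y"] by simp
  qed
  moreover have "adjoint_on N B y = A y" if "y \<in> N" for y
    using AB[OF _ that] mem that N by (intro adjoint_on_eqI) auto
  moreover have "adjoint_on N P y = y" if "y \<in> N" for y
    using P that N by (intro adjoint_on_eqI) auto
  ultimately have "normal_on N A" "normal_on N B" "normal_on N P"
    using b mem comm P by (auto simp: normal_on_def)
  moreover have "taylor_spectrum_on N A B P \<subseteq> b_tetrablock"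
  proof clarify
    fix l1 l2 l3
    assume l: "(l1, l2, l3) \<in> taylor_spectrum_on N A B P"
    have "l3 = 1"
      using taylor_spectrum_third_coordinate[OF T _ l] P by blast
    moreover have "(l1, l2, l3) \<in> closure tetrablock"
      using S l by (auto simp: spectral_set_on_def)
    ultimately show "(l1, l2, l3) \<in> b_tetrablock"
      by (simp add: b_tetrablock_def)
  qed
  ultimately show ?thesis
    using T by (simp add: E_unitary_on_def)
qed


section \<open>The decomposition theorem\<close>

text \<open>
  Stated for one summand, so that it serves both for the closed range and, with the summands
  exchanged, for the kernel.
\<close>

lemma orthogonal_summand_reduces_and_E_contraction:
  assumes E: "E_contraction_on UNIV A B (P::'h::chilbert_space \<Rightarrow> 'h)" and MN: "orthogonal_sum M N"
    and inv: "\<And>T. T \<in> {A, B, P} \<Longrightarrow> T ` M \<subseteq> M \<and> T ` N \<subseteq> N"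
  shows "reduces M A \<and> reduces M B \<and> E_contraction_on M A B P"
proof -
  have b: "bounded_op_on UNIV A" "bounded_op_on UNIV B" "bounded_op_on UNIV P"
    using E by (auto simp: E_contraction_on_def commuting_triple_on_def)
  obtain Q where Q: "bounded_op_on UNIV Q" "range Q \<subseteq> M" "\<And>x. x \<in> M \<Longrightarrow> Q x = x"
    and comm: "\<And>T x. bounded_op_on UNIV T \<Longrightarrow> T ` M \<subseteq> M \<Longrightarrow> T ` N \<subseteq> N \<Longrightarrow> Q (T x) = T (Q x)"
    using orthogonal_sum_projection[OF MN] by blast
  have "E_contraction_on M A B P"
  proof (rule E_contraction_on_restrict[OF E])
    show "closed_csubspace M"
      using MN by (simp add: orthogonal_sum_def)
    show "projection_onto M Q"
      using Q by (simp add: projection_onto_def)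
  qed (rule comm; use b inv in blast)+
  then show ?thesis
    using reduces_of_orthogonal_sum[OF MN] b inv by blast
qed

theorem theorem5p6:
  fixes A B P :: "'h::chilbert_space \<Rightarrow> 'h"
  assumes "E_contraction_on UNIV A B P"
  shows "(reduces (Ran_I_minus_closure P) A \<and> reduces (Ran_I_minus_closure P) B \<and>
          reduces (Ker_I_minus P) A \<and> reduces (Ker_I_minus P) B) \<and>
         E_contraction_on (Ran_I_minus_closure P) A B P \<and>
         E_unitary_on (Ker_I_minus P) A B P"
proof -
  let ?M = "Ran_I_minus_closure P" and ?N = "Ker_I_minus P"
  have T: "commuting_triple_on UNIV A B P"
    using assms by (simp add: E_contraction_on_def)
  have inv: "T ` ?M \<subseteq> ?M \<and> T ` ?N \<subseteq> ?N" if "T \<in> {A, B, P}" for T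
  proof -
    have "bounded_linear T" "\<And>x. T (P x) = P (T x)"
      using that T bounded_op_on_bounded_linear by (auto simp: commuting_triple_on_def)
    then show ?thesis
      by (intro conjI Ran_I_minus_closure_invariant Ker_I_minus_invariant)
  qed
  have MN: "orthogonal_sum ?M ?N"
    using T E_contraction_contraction[OF assms]
    by (intro orthogonal_sum_Ran_Ker) (auto simp: commuting_triple_on_def)
  have M: "reduces ?M A \<and> reduces ?M B \<and> E_contraction_on ?M A B P"
    using inv by (intro orthogonal_summand_reduces_and_E_contraction[OF assms MN]) blast
  have N: "reduces ?N A \<and> reduces ?N B \<and> E_contraction_on ?N A B P"
    using inv
    by (intro orthogonal_summand_reduces_and_E_contraction[OF assms orthogonal_sum_commute[OF MN]]) blast
  moreover have "E_unitary_on ?N A B P"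
    using N by (intro E_unitary_on_of_identity) (auto simp: Ker_I_minus_def)
  ultimately show ?thesis
    using M by blast
qed

end
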